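(* Let $\eta=(X_n)_{n\ge1}$ be the independent Gaussian process (i.i.d. standard Gaussian variables) with law $\gamma$. Let $(\Omega,T,\mu)$ be a dynamical system, $F\in AC(\Omega,T,\mu)$, and let $\nu$ be the law of the process $\xi:=(F,F\circ T,F\circ T^2,\dots)$. Then: (i) $Se(F,T)$ is finite if and only if the entropy rate $\bar H_\eta(\xi)$ of $\xi$ with respect to $\eta$ is finite; (ii) $\nu=\gamma$ if and only if $\bar H_\eta(\xi)=0$; (iii) $Se(F,T)=\frac12\left(\log(2\pi)+\|F\|_2^2\right)-\bar H_\eta(\xi)$.
   Context: A dynamical system $(\Omega,T,\mu)$ is a probability space with a measure-preserving transformation. $AC(\Omega,T,\mu)$ denotes the set of real-valued $F\in L^2(\mu)$ such that for every $n\ge 1$ the law $\mu F_n^{-1}$ of $F_n:=(F,F\circ T,\dots,F\circ T^{n-1})$ is absolutely continuous with respect to Lebesgue measure $l^n$ on $\mathbb R^n$. With $\psi(x)=-x\log x$, $\psi(0)=0$, set $H_n(F):=\int_{\mathbb R^n}\psi\left(\frac{d\mu F_n^{-1}}{dl^n}\right)dl^n\in[-\infty,\infty)$ and $Se(F,T):=\lim_n\frac1nH_n(F)\in[-\infty,\infty)$ (the limit exists). For probability measures $P,Q$ on the same measurable space, $H_Q(P):=\sup_\Pi\sum_{E\in\Pi}P(E)\log\frac{P(E)}{Q(E)}\in[0,\infty]$, the supremum over finite measurable partitions. The entropy rate of a stationary process $\xi=(\xi_n)_{n\ge1}$ with respect to a stationary process $\eta=(\eta_n)_{n\ge1}$ is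 $\bar H_\eta(\xi):=\lim_n\frac1nH_{P_{(\eta_1,\dots,\eta_n)}}(P_{(\xi_1,\dots,\xi_n)})$, where $P_Z$ is the law of $Z$; this limit exists in $[0,\infty]$ when $\eta$ is the independent Gaussian process. *)

theory Defs
  imports "HOL-Probability.Probability"
begin

locale dynamical_system = prob_space M for M :: "'a measure" and T :: "'a \<Rightarrow> 'a" +
  assumes measurable_T: "T \<in> M \<rightarrow>\<^sub>M M"
    and preserving_T: "distr M M T = M"

text \<open>
  Processes are indexed from \<open>0\<close>: the \<open>n\<close>-th variable (\<open>n \<ge> 1\<close>) of the usual numbering is
  \<open>X (n - 1)\<close>. The space \<open>\<real>\<^sup>n\<close> is the product over \<open>{..<n}\<close>, with its Borel sets, and carries
  Lebesgue measure \<open>leb n\<close>; real sequences carry the product sigma-algebra.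
\<close>

definition leb :: "nat \<Rightarrow> (nat \<Rightarrow> real) measure" where
  "leb n = Pi\<^sub>M {..<n} (\<lambda>_. lborel)"

definition block_law :: "'a measure \<Rightarrow> (nat \<Rightarrow> 'a \<Rightarrow> real) \<Rightarrow> nat \<Rightarrow> (nat \<Rightarrow> real) measure" where
  "block_law M X n = distr M (Pi\<^sub>M {..<n} (\<lambda>_. borel)) (\<lambda>\<omega>. \<lambda>i\<in>{..<n}. X i \<omega>)"

definition process_law :: "'a measure \<Rightarrow> (nat \<Rightarrow> 'a \<Rightarrow> real) \<Rightarrow> (nat \<Rightarrow> real) measure" where
  "process_law M X = distr M (Pi\<^sub>M UNIV (\<lambda>_. borel)) (\<lambda>\<omega> i. X i \<omega>)"

definition orbit_process :: "('a \<Rightarrow> real) \<Rightarrow> ('a \<Rightarrow> 'a) \<Rightarrow> nat \<Rightarrow> 'a \<Rightarrow> real" where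
  "orbit_process F T i \<omega> = F ((T ^^ i) \<omega>)"

definition independent_gaussian_process :: "'a measure \<Rightarrow> (nat \<Rightarrow> 'a \<Rightarrow> real) \<Rightarrow> bool" where
  "independent_gaussian_process N X \<longleftrightarrow>
     prob_space N \<and>
     prob_space.indep_vars N (\<lambda>_. borel) X UNIV \<and>
     (\<forall>i. distributed N lborel (X i) std_normal_density)"

definition AC :: "'a measure \<Rightarrow> ('a \<Rightarrow> 'a) \<Rightarrow> ('a \<Rightarrow> real) set" where
  "AC M T = {F \<in> borel_measurable M. integrable M (\<lambda>\<omega>. (F \<omega>)\<^sup>2) \<and>
     (\<forall>n\<ge>1. absolutely_continuous (leb n) (block_law M (orbit_process F T) n))}"

definition L2_norm :: "'a measure \<Rightarrow> ('a \<Rightarrow> real) \<Rightarrow> real" where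
  "L2_norm M F = sqrt (\<integral>\<omega>. (F \<omega>)\<^sup>2 \<partial>M)"

text \<open>
  The integral of a measurable function, as an extended real. The Bochner integral would give
  the value \<open>0\<close> where the integral is \<open>-\<infinity>\<close>. If both parts are infinite, the value is \<open>\<infinity>\<close>;
  this does not happen for the entropy of a random vector in \<open>L\<^sup>2\<close>, whose positive part is finite.
\<close>

definition ext_integral :: "'a measure \<Rightarrow> ('a \<Rightarrow> real) \<Rightarrow> ereal" where
  "ext_integral M f =
     enn2ereal (\<integral>\<^sup>+x. ennreal (f x) \<partial>M) - enn2ereal (\<integral>\<^sup>+x. ennreal (- f x) \<partial>M)"

definition psi :: "real \<Rightarrow> real" where
  "psi x = (if x = 0 then 0 else - x * ln x)"

definition block_entropy :: "'a measure \<Rightarrow> ('a \<Rightarrow> 'a) \<Rightarrow> ('a \<Rightarrow> real) \<Rightarrow> nat \<Rightarrow> ereal" where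
  "block_entropy M T F n =
     ext_integral (leb n)
       (\<lambda>x. psi (enn2real (RN_deriv (leb n) (block_law M (orbit_process F T) n) x)))"

definition Se :: "'a measure \<Rightarrow> ('a \<Rightarrow> 'a) \<Rightarrow> ('a \<Rightarrow> real) \<Rightarrow> ereal" where
  "Se M T F = lim (\<lambda>n. ereal (1 / real n) * block_entropy M T F n)"

text \<open>The summand \<open>p log (p / q)\<close>, with \<open>0 log (0 / q) = 0\<close> and \<open>p log (p / 0) = \<infinity>\<close> for \<open>p > 0\<close>.\<close>

definition entropy_term :: "real \<Rightarrow> real \<Rightarrow> ereal" where
  "entropy_term p q = (if p = 0 then 0 else if q = 0 then \<infinity> else ereal (p * ln (p / q)))"

definition rel_entropy :: "'a measure \<Rightarrow> 'a measure \<Rightarrow> ereal" where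
  "rel_entropy Q P =
     (SUP \<E> \<in> {\<E>. finite \<E> \<and> \<E> \<subseteq> sets Q \<and> partition_on (space Q) \<E>}.
        \<Sum>E\<in>\<E>. entropy_term (measure P E) (measure Q E))"

definition entropy_rate ::
  "'b measure \<Rightarrow> (nat \<Rightarrow> 'b \<Rightarrow> real) \<Rightarrow> 'a measure \<Rightarrow> (nat \<Rightarrow> 'a \<Rightarrow> real) \<Rightarrow> ereal" where
  "entropy_rate N \<eta> M \<xi> =
     lim (\<lambda>n. ereal (1 / real n) * rel_entropy (block_law N \<eta> n) (block_law M \<xi> n))"

end

theory Submission
  imports Defs
begin

text \<open>
  The relative entropy of the \<open>n\<close>-block of \<open>\<xi>\<close> with respect to the Gaussian block equals
  \<open>\<integral> g ln g - g + 1\<close> against the Gaussian law, \<open>g\<close> being the density of one law with respect to the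
  other. Both inequalities come from \<open>a ln a - a + 1 = sup\<^sub>t (a ln t - t + 1)\<close>. As the
  logarithm of the Gaussian density is quadratic and \<open>\<xi>\<close> is stationary with second moment
  \<open>\<parallel>F\<parallel>\<^sup>2\<close>, this turns \<open>H\<^sub>n(F)\<close> into \<open>n/2 (log(2\<pi>) + \<parallel>F\<parallel>\<^sup>2)\<close> minus the relative entropy.

  Stationarity of \<open>\<xi>\<close> and independence of the Gaussian blocks make the relative entropies
  superadditive in \<open>n\<close>, so by Fekete's lemma the rate exists and is the supremum of the
  relative entropies divided by \<open>n\<close>. Hence a zero rate forces every relative entropy to vanish, and by the
  equality case of Gibbs' inequality all finite-dimensional laws agree.
\<close>

subsection \<open>Relative entropy\<close>

text \<open>For fixed \<open>a\<close> the left side is maximal at \<open>t = a\<close>; for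
  \<open>a > 0\<close> this is \<open>ln y \<le> y - 1\<close> at \<open>y = t / a\<close>. The free
  \<open>t\<close> allows integration with \<open>t\<close> constant on a set, and
  \<open>t = 1\<close> shows that the right side is nonnegative.\<close>

lemma ln_mult_le:
  fixes a t :: real
  assumes "0 \<le> a" "0 < t"
  shows "a * ln t - t + 1 \<le> a * ln a - a + 1"
proof (cases "a = 0")
  case False
  then have a: "0 < a" using assms by simp
  have "a * ln (t / a) \<le> a * (t / a - 1)"
    using a assms by (intro mult_left_mono ln_le_minus_one) auto
  then show ?thesis
    using a assms by (simp add: ln_div algebra_simps)
qed (use assms in simp)

text \<open>The same bound \<open>ln y \<le> y - 1\<close>, now at \<open>y = q / p\<close>. Summed
  over a partition, the differences \<open>p - q\<close> of two probabilities cancel, which is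
  Gibbs' inequality.\<close>

lemma mult_ln_div_ge:
  fixes p q :: real
  assumes "0 \<le> p" "0 \<le> q" "q = 0 \<Longrightarrow> p = 0"
  shows "p - q \<le> p * ln (p / q)"
proof (cases "p = 0")
  case False
  then have "0 < p" "0 < q" using assms by (auto simp: less_le)
  then have "p * ln (q / p) \<le> p * (q / p - 1)"
    by (intro mult_left_mono ln_le_minus_one) auto
  then show ?thesis
    using \<open>0 < p\<close> \<open>0 < q\<close> by (simp add: ln_div algebra_simps)
qed (use assms in simp)

text \<open>\<open>ln y = y - 1\<close> only at \<open>y = 1\<close>; for \<open>p = 0\<close> the
  equation already reads \<open>0 = - q\<close>.\<close>

lemma mult_ln_div_eq_diff_iff:
  fixes p q :: real
  assumes "0 \<le> p" "0 \<le> q" "q = 0 \<Longrightarrow> p = 0"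
  shows "p * ln (p / q) = p - q \<longleftrightarrow> p = q"
proof
  assume eq: "p * ln (p / q) = p - q"
  show "p = q"
  proof (cases "p = 0")
    case False
    then have pos: "0 < p" "0 < q" using assms by (auto simp: less_le)
    have "ln (q / p) = q / p - 1"
      using eq pos by (simp add: ln_div field_simps)
    then have "q / p = 1" by (rule ln_eq_minus_one[rotated]) (use pos in simp)
    then show ?thesis using pos by simp
  qed (use eq in simp)
qed (use assms in auto)

lemma entropy_term_ereal:
  assumes "q = 0 \<Longrightarrow> p = 0"
  shows "entropy_term p q = ereal (p * ln (p / q))"
  using assms by (auto simp: entropy_term_def)

lemma absolutely_continuous_measure_eq_0:
  assumes "absolutely_continuous Q P" "prob_space Q" "E \<in> sets Q" "measure Q E = 0"
  shows "measure P E = 0"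
proof -
  interpret Q: prob_space Q by fact
  have "E \<in> null_sets Q"
    using assms(3,4) by (auto intro!: null_setsI simp: Q.emeasure_eq_measure)
  then have "E \<in> null_sets P"
    using assms(1) by (auto simp: absolutely_continuous_def)
  then show ?thesis by (auto simp: measure_def)
qed

text \<open>\<open>rel_entropy\<close> ranges over sets of nonempty cells, whereas later arguments
  produce indexed families that may repeat the empty set. Empty cells contribute \<open>0\<close>,
  and on the remaining indices disjointness makes \<open>A\<close> injective.\<close>

lemma sum_entropy_term_le_rel_entropy:
  assumes "finite I" "\<And>i. i \<in> I \<Longrightarrow> A i \<in> sets Q" "disjoint_family_on A I"
    and "(\<Union>i\<in>I. A i) = space Q"
  shows "(\<Sum>i\<in>I. entropy_term (measure P (A i)) (measure Q (A i))) \<le> rel_entropy Q P"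
proof -
  define J where "J = {i \<in> I. A i \<noteq> {}}"
  have J: "J \<subseteq> I" "finite J" using \<open>finite I\<close> by (auto simp: J_def)
  have inj: "inj_on A J"
    using assms(3) by (fastforce simp: inj_on_def J_def disjoint_family_on_def)
  have part: "partition_on (space Q) (A ` J)"
    using assms(3,4) unfolding partition_on_def disjoint_def disjoint_family_on_def J_def
    by (auto 0 4)
  have "(\<Sum>i\<in>I. entropy_term (measure P (A i)) (measure Q (A i)))
      = (\<Sum>i\<in>J. entropy_term (measure P (A i)) (measure Q (A i)))"
    using \<open>finite I\<close> J(1) by (intro sum.mono_neutral_right) (auto simp: J_def entropy_term_def)
  also have "\<dots> = (\<Sum>E\<in>A ` J. entropy_term (measure P E) (measure Q E))"
    using inj by (simp add: sum.reindex)
  also have "\<dots> \<le> rel_entropy Q P"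
    unfolding rel_entropy_def using J part assms(2) by (intro SUP_upper) auto
  finally show ?thesis .
qed

lemma rel_entropy_nonneg:
  assumes "prob_space P" "prob_space Q" "space P = space Q"
  shows "0 \<le> rel_entropy Q P"
  using sum_entropy_term_le_rel_entropy[of "{()}" "\<lambda>_. space Q" Q P]
    prob_space.prob_space[OF assms(1)] prob_space.prob_space[OF assms(2)] assms(3)
  by (simp add: entropy_term_def disjoint_family_on_def zero_ereal_def)

lemma rel_entropy_self:
  assumes "prob_space P"
  shows "rel_entropy P P = 0"
proof (rule antisym)
  show "rel_entropy P P \<le> 0"
    unfolding rel_entropy_def
    by (intro SUP_least) (simp add: entropy_term_def zero_ereal_def sum.neutral)
qed (use assms in \<open>intro rel_entropy_nonneg, auto\<close>)

text \<open>Partitions into \<open>E\<close> and its complement suffice. The two terms are at least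
  \<open>p - q\<close> and \<open>(1 - p) - (1 - q)\<close>, which add up to \<open>0\<close>; a sum
  that is not positive therefore forces equality in both.\<close>

lemma rel_entropy_eq_0_imp_eq:
  assumes "prob_space P" "prob_space Q" "sets P = sets Q" "absolutely_continuous Q P"
    and "rel_entropy Q P \<le> 0"
  shows "P = Q"
proof (rule measure_eqI)
  fix E assume "E \<in> sets P"
  then have E: "E \<in> sets Q" "space Q - E \<in> sets Q" "E \<subseteq> space Q"
    using assms(3) sets.sets_into_space by auto
  interpret P: prob_space P by fact
  interpret Q: prob_space Q by fact
  define p q where "p = measure P E" and "q = measure Q E"
  have sp: "space P = space Q" using assms(3) by (rule sets_eq_imp_space_eq)
  have compl: "measure P (space Q - E) = 1 - p" "measure Q (space Q - E) = 1 - q"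
    using E(1) assms(3) P.prob_compl[of E] Q.prob_compl[of E] by (auto simp: p_def q_def sp)
  have ac: "q = 0 \<Longrightarrow> p = 0" "1 - q = 0 \<Longrightarrow> 1 - p = 0"
    using absolutely_continuous_measure_eq_0[OF assms(4,2)] E compl by (auto simp: p_def q_def)
  \<comment> \<open>Indexing the two cells by booleans also covers the case that \<open>E\<close> or
    its complement is empty.\<close>
  have "(\<Sum>i\<in>UNIV. entropy_term (measure P (if i then E else space Q - E))
      (measure Q (if i then E else space Q - E))) \<le> rel_entropy Q P"
    using E by (intro sum_entropy_term_le_rel_entropy) (auto simp: disjoint_family_on_def UNIV_bool)
  then have "entropy_term p q + entropy_term (1 - p) (1 - q) \<le> 0"
    using assms(5) by (simp add: UNIV_bool compl p_def[symmetric] q_def[symmetric] add.commute)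
  then have "p * ln (p / q) + (1 - p) * ln ((1 - p) / (1 - q)) \<le> 0"
    using ac by (simp add: entropy_term_ereal)
  moreover have "p - q \<le> p * ln (p / q)"
    using ac by (intro mult_ln_div_ge) (auto simp: p_def q_def)
  moreover have "(1 - p) - (1 - q) \<le> (1 - p) * ln ((1 - p) / (1 - q))"
    using ac by (intro mult_ln_div_ge) (auto simp: p_def q_def)
  ultimately have "p * ln (p / q) = p - q" by linarith
  then have "p = q"
    using ac by (subst (asm) mult_ln_div_eq_diff_iff) (auto simp: p_def q_def)
  then show "emeasure P E = emeasure Q E"
    by (simp add: p_def q_def P.emeasure_eq_measure Q.emeasure_eq_measure)
qed (use assms in simp)

section \<open>Superadditivity under independence\<close>

lemma sum_ereal_not_MInfty:
  fixes f :: "'i \<Rightarrow> ereal"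
  assumes "\<And>i. i \<in> I \<Longrightarrow> f i \<noteq> - \<infinity>"
  shows "sum f I \<noteq> - \<infinity>"
  using assms by (induction I rule: infinite_finite_induct) auto

text \<open>Adding a constant commutes with a nonempty supremum in \<open>ereal\<close> unless the
  constant is \<open>- \<infinity>\<close>: as
  \<open>\<infinity> + - \<infinity> = \<infinity>\<close>, an infinite supremum of finite values
  would break the identity.\<close>

lemma SUP_add_SUP_le:
  fixes f :: "'i \<Rightarrow> ereal" and g :: "'j \<Rightarrow> ereal"
  assumes "I \<noteq> {}" "J \<noteq> {}"
    and f: "\<And>i. i \<in> I \<Longrightarrow> f i \<noteq> - \<infinity>" and g: "\<And>j. j \<in> J \<Longrightarrow> g j \<noteq> - \<infinity>"
    and le: "\<And>i j. i \<in> I \<Longrightarrow> j \<in> J \<Longrightarrow> f i + g j \<le> z"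
  shows "(SUP i\<in>I. f i) + (SUP j\<in>J. g j) \<le> z"
proof -
  obtain j where "j \<in> J" using \<open>J \<noteq> {}\<close> by auto
  then have "g j \<le> (SUP j\<in>J. g j)" by (rule SUP_upper)
  then have *: "(SUP j\<in>J. g j) \<noteq> - \<infinity>" using g[OF \<open>j \<in> J\<close>] by auto
  have "f i + (SUP j\<in>J. g j) \<le> z" if "i \<in> I" for i
    using le that by (subst SUP_ereal_add_right[symmetric]) (auto intro!: SUP_least \<open>J \<noteq> {}\<close> f)
  then show ?thesis
    by (subst SUP_ereal_add_left[symmetric]) (auto intro!: SUP_least \<open>I \<noteq> {}\<close> simp: *)
qed

text \<open>Two partitions are joined into the partition by product cells. With joint masses
  \<open>r\<close> and marginals \<open>p\<close>, \<open>p'\<close> under \<open>P\<close>, and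
  product masses \<open>q * q'\<close> under \<open>Q\<close>, the term
  \<open>r ln (r / (q q'))\<close> splits into
  \<open>r ln (p / q) + r ln (p' / q') + r ln (r / (p p'))\<close>. The last part is a mutual
  information, whose sum is nonnegative by Gibbs' inequality.\<close>

lemma rel_entropy_superadditive:
  assumes "prob_space P" "prob_space Q" "sets P = sets Q" "absolutely_continuous Q P"
    and a: "a \<in> Q \<rightarrow>\<^sub>M A" and b: "b \<in> Q \<rightarrow>\<^sub>M B"
    and indep: "\<And>E E'. E \<in> sets A \<Longrightarrow> E' \<in> sets B \<Longrightarrow>
      measure Q (a -` E \<inter> b -` E' \<inter> space Q) = measure (distr Q A a) E * measure (distr Q B b) E'"
  shows "rel_entropy (distr Q A a) (distr P A a) + rel_entropy (distr Q B b) (distr P B b)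
    \<le> rel_entropy Q P"
proof -
  interpret P: prob_space P by fact
  interpret Q: prob_space Q by fact
  have sp: "space P = space Q" using assms(3) by (rule sets_eq_imp_space_eq)
  have [measurable]: "a \<in> P \<rightarrow>\<^sub>M A" "b \<in> P \<rightarrow>\<^sub>M B"
    using a b by (simp_all cong: measurable_cong_sets add: assms(3))
  note [measurable] = a b
  let ?s = "\<lambda>A a. {\<E>. finite \<E> \<and> \<E> \<subseteq> sets (distr Q A a) \<and> partition_on (space (distr Q A a)) \<E>}"
  let ?t = "\<lambda>A a \<E>. \<Sum>E\<in>\<E>. entropy_term (measure (distr P A a) E) (measure (distr Q A a) E)"
  have *: "?t A a \<E> + ?t B b \<F> \<le> rel_entropy Q P"
    if \<E>: "\<E> \<in> ?s A a" and \<F>: "\<F> \<in> ?s B b" for \<E> \<F>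
  proof -
    define p q where "p E = measure P (a -` E \<inter> space Q)" and "q E = measure Q (a -` E \<inter> space Q)" for E
    define p' q' where "p' E = measure P (b -` E \<inter> space Q)" and "q' E = measure Q (b -` E \<inter> space Q)" for E
    define S where "S = (\<lambda>(E, E'). a -` E \<inter> b -` E' \<inter> space Q)"
    define r where "r E E' = measure P (S (E, E'))" for E E'
    have fin[simp]: "finite \<E>" "finite \<F>" using \<E> \<F> by auto
    have sets: "E \<in> sets A" if "E \<in> \<E>" for E using \<E> that by auto
    have sets': "E \<in> sets B" if "E \<in> \<F>" for E using \<F> that by auto
    have meas[measurable]: "a -` E \<inter> space Q \<in> sets Q" if "E \<in> \<E>" for E
      using sets[OF that] by measurable
    have meas'[measurable]: "b -` E \<inter> space Q \<in> sets Q" if "E \<in> \<F>" for E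
      using sets'[OF that] by measurable
    have Smeas: "S (E, E') \<in> sets Q" if "E \<in> \<E>" "E' \<in> \<F>" for E E'
    proof -
      have "S (E, E') = (a -` E \<inter> space Q) \<inter> (b -` E' \<inter> space Q)" by (auto simp: S_def)
      then show ?thesis using meas[OF that(1)] meas'[OF that(2)] by simp
    qed
    have cov: "\<Union>\<E> = space A" "disjoint \<E>" using \<E> by (auto simp: partition_on_def)
    have cov': "\<Union>\<F> = space B" "disjoint \<F>" using \<F> by (auto simp: partition_on_def)
    have aS: "a x \<in> space A" "b x \<in> space B" if "x \<in> space Q" for x
      using measurable_space[OF a that] measurable_space[OF b that] by auto
    have row: "(\<Sum>E'\<in>\<F>. r E E') = p E" if "E \<in> \<E>" for E
    proof -
      have "(\<Sum>E'\<in>\<F>. r E E') = measure P (\<Union>E'\<in>\<F>. S (E, E'))"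
        unfolding r_def using Smeas[OF that] cov'(2)
        by (intro P.finite_measure_finite_Union[symmetric])
          (auto simp: assms(3) disjoint_family_on_def disjoint_def S_def)
      also have "(\<Union>E'\<in>\<F>. S (E, E')) = a -` E \<inter> space Q"
        using aS unfolding cov'(1)[symmetric] by (auto simp: S_def)
      finally show ?thesis by (simp add: p_def)
    qed
    have col: "(\<Sum>E\<in>\<E>. r E E') = p' E'" if "E' \<in> \<F>" for E'
    proof -
      have "(\<Sum>E\<in>\<E>. r E E') = measure P (\<Union>E\<in>\<E>. S (E, E'))"
        unfolding r_def using Smeas[OF _ that] cov(2)
        by (intro P.finite_measure_finite_Union[symmetric])
          (auto simp: assms(3) disjoint_family_on_def disjoint_def S_def)
      also have "(\<Union>E\<in>\<E>. S (E, E')) = b -` E' \<inter> space Q"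
        using aS unfolding cov(1)[symmetric] by (auto simp: S_def)
      finally show ?thesis by (simp add: p'_def)
    qed
    have psum: "(\<Sum>E\<in>\<E>. p E) = 1"
    proof -
      have "(\<Sum>E\<in>\<E>. p E) = measure P (\<Union>E\<in>\<E>. a -` E \<inter> space Q)"
        unfolding p_def using meas cov(2)
        by (intro P.finite_measure_finite_Union[symmetric])
          (auto simp: assms(3) disjoint_family_on_def disjoint_def)
      also have "(\<Union>E\<in>\<E>. a -` E \<inter> space Q) = space P"
        using aS unfolding cov(1)[symmetric] by (auto simp: sp)
      finally show ?thesis by (simp add: P.prob_space)
    qed
    have p'sum: "(\<Sum>E\<in>\<F>. p' E) = 1"
    proof -
      have "(\<Sum>E\<in>\<F>. p' E) = measure P (\<Union>E\<in>\<F>. b -` E \<inter> space Q)"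
        unfolding p'_def using meas' cov'(2)
        by (intro P.finite_measure_finite_Union[symmetric])
          (auto simp: assms(3) disjoint_family_on_def disjoint_def)
      also have "(\<Union>E\<in>\<F>. b -` E \<inter> space Q) = space P"
        using aS unfolding cov'(1)[symmetric] by (auto simp: sp)
      finally show ?thesis by (simp add: P.prob_space)
    qed
    have qS: "measure Q (S (E, E')) = q E * q' E'" if "E \<in> \<E>" "E' \<in> \<F>" for E E'
      using indep[OF sets[OF that(1)] sets'[OF that(2)]] sets[OF that(1)] sets'[OF that(2)]
      by (simp add: S_def q_def q'_def measure_distr)
    have ac: "p E = 0" if "E \<in> \<E>" "q E = 0" for E
      using absolutely_continuous_measure_eq_0[OF assms(4,2) meas[OF that(1)]] that(2)
      by (simp add: p_def q_def)
    have ac': "p' E = 0" if "E \<in> \<F>" "q' E = 0" for E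
      using absolutely_continuous_measure_eq_0[OF assms(4,2) meas'[OF that(1)]] that(2)
      by (simp add: p'_def q'_def)
    have nonneg: "0 \<le> p E" "0 \<le> q E" "0 \<le> p' E'" "0 \<le> q' E'" "0 \<le> r E E'" for E E'
      by (auto simp: p_def q_def p'_def q'_def r_def)
    \<comment> \<open>A product cell has no more mass than its row or column. So wherever a marginal
      vanishes, and its logarithm is a mere default value, the factor \<open>r\<close> vanishes
      too.\<close>
    have r0: "r E E' = 0" if "E \<in> \<E>" "E' \<in> \<F>" "p E = 0 \<or> p' E' = 0" for E E'
      using that(3)
    proof
      assume "p E = 0"
      then show ?thesis
        using row[OF that(1)] nonneg(5) that(2) by (simp add: sum_nonneg_eq_0_iff)
    next
      assume "p' E' = 0"
      then show ?thesis
        using col[OF that(2)] nonneg(5) that(1) by (simp add: sum_nonneg_eq_0_iff)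
    qed
    \<comment> \<open>Gibbs' inequality compares the joint mass with the product of the
      marginals.\<close>
    have gibbs: "r E E' * ln (p E / q E) + r E E' * ln (p' E' / q' E') + r E E' - p E * p' E'
        \<le> r E E' * ln (r E E' / (q E * q' E'))" if "E \<in> \<E>" "E' \<in> \<F>" for E E'
    proof (cases "r E E' = 0")
      case False
      then have pos: "0 < r E E'" "0 < p E" "0 < p' E'"
        using nonneg r0[OF that] by (auto simp: less_le)
      then have pos': "0 < q E" "0 < q' E'"
        using nonneg ac[OF that(1)] ac'[OF that(2)] by (auto simp: less_le)
      have "r E E' - p E * p' E' \<le> r E E' * ln (r E E' / (p E * p' E'))"
        using pos by (intro mult_ln_div_ge) auto
      then show ?thesis
        using pos pos' by (simp add: ln_div ln_mult algebra_simps)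
    qed (use nonneg in simp)
    have "?t A a \<E> + ?t B b \<F>
      = ereal ((\<Sum>E\<in>\<E>. p E * ln (p E / q E)) + (\<Sum>E\<in>\<F>. p' E * ln (p' E / q' E)))"
      using sets sets' ac ac'
      by (simp add: measure_distr entropy_term_ereal p_def q_def p'_def q'_def sp)
    \<comment> \<open>Row and column sums of \<open>r\<close> restore the marginals in the
      logarithmic terms. The correction \<open>r - p * p'\<close> has total
      \<open>1 - 1 = 0\<close>.\<close>
    also have "(\<Sum>E\<in>\<E>. p E * ln (p E / q E)) + (\<Sum>E\<in>\<F>. p' E * ln (p' E / q' E))
      = (\<Sum>E\<in>\<E>. \<Sum>E'\<in>\<F>. r E E' * ln (p E / q E) + r E E' * ln (p' E' / q' E')
          + r E E' - p E * p' E')"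
    proof -
      have "(\<Sum>E\<in>\<E>. \<Sum>E'\<in>\<F>. r E E' * ln (p E / q E)) = (\<Sum>E\<in>\<E>. p E * ln (p E / q E))"
        by (simp add: sum_distrib_right[symmetric] row)
      moreover have "(\<Sum>E\<in>\<E>. \<Sum>E'\<in>\<F>. r E E' * ln (p' E' / q' E')) = (\<Sum>E\<in>\<F>. p' E * ln (p' E / q' E))"
        by (subst sum.swap) (simp add: sum_distrib_right[symmetric] col)
      moreover have "(\<Sum>E\<in>\<E>. \<Sum>E'\<in>\<F>. r E E') = 1" by (simp add: row psum)
      moreover have "(\<Sum>E\<in>\<E>. \<Sum>E'\<in>\<F>. p E * p' E') = 1"
        by (simp add: sum_distrib_left[symmetric] psum p'sum)
      ultimately show ?thesis by (simp add: sum.distrib sum_subtractf)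
    qed
    also have "ereal \<dots> \<le> ereal (\<Sum>E\<in>\<E>. \<Sum>E'\<in>\<F>. r E E' * ln (r E E' / (q E * q' E')))"
      using gibbs by (auto intro!: sum_mono)
    also have "\<dots> = (\<Sum>i\<in>\<E> \<times> \<F>. entropy_term (measure P (S i)) (measure Q (S i)))"
    proof -
      have "entropy_term (measure P (S (E, E'))) (measure Q (S (E, E')))
        = ereal (r E E' * ln (r E E' / (q E * q' E')))" if "E \<in> \<E>" "E' \<in> \<F>" for E E'
        using absolutely_continuous_measure_eq_0[OF assms(4,2) Smeas[OF that]] qS[OF that]
        by (subst entropy_term_ereal) (auto simp: r_def)
      then show ?thesis
        by (subst sum.cartesian_product') (simp add: sum.cartesian_product')
    qed
    also have "\<dots> \<le> rel_entropy Q P"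
    proof (rule sum_entropy_term_le_rel_entropy)
      show "disjoint_family_on S (\<E> \<times> \<F>)"
        using disjointD[OF cov(2)] disjointD[OF cov'(2)]
        by (auto simp: disjoint_family_on_def S_def) blast+
      show "\<Union> (S ` (\<E> \<times> \<F>)) = space Q"
        using aS unfolding cov(1)[symmetric] cov'(1)[symmetric] by (fastforce simp: S_def)
    qed (auto intro: Smeas)
    finally show ?thesis .
  qed
  \<comment> \<open>The one-cell partition is admissible only if the space is nonempty, since cells
    are; the space of the probability measure \<open>Q\<close> is nonempty and is mapped into
    \<open>A\<close> and \<open>B\<close>.\<close>
  have ne: "?s A a \<noteq> {}" "?s B b \<noteq> {}"
  proof -
    have "space A \<noteq> {}" "space B \<noteq> {}"
      using Q.not_empty measurable_space[OF a] measurable_space[OF b] by blast+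
    then have "{space A} \<in> ?s A a" "{space B} \<in> ?s B b"
      by (auto simp: partition_on_def)
    then show "?s A a \<noteq> {}" "?s B b \<noteq> {}" by blast+
  qed
  show ?thesis
    unfolding rel_entropy_def[of "distr Q A a"] rel_entropy_def[of "distr Q B b"]
  proof (rule SUP_add_SUP_le[OF ne])
    show "?t A a \<E> \<noteq> - \<infinity>" for \<E>
      by (rule sum_ereal_not_MInfty) (simp add: entropy_term_def)
    show "?t B b \<F> \<noteq> - \<infinity>" for \<F>
      by (rule sum_ereal_not_MInfty) (simp add: entropy_term_def)
  qed (rule *)
qed

subsection \<open>Relative entropy of a density\<close>

text \<open>With all \<open>c i = 1\<close> on a partition this recovers the total integral of
  \<open>f\<close>; with \<open>c\<close> ranging over the values of a simple function it integrates
  \<open>f\<close> against that function.\<close>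

lemma sum_measure_mult_eq_integral:
  fixes f :: "'a \<Rightarrow> real"
  assumes f: "integrable M f" and A: "\<And>i. i \<in> I \<Longrightarrow> A i \<in> sets M"
  shows "(\<Sum>i\<in>I. c i * (\<integral>x. f x * indicator (A i) x \<partial>M))
    = (\<integral>x. f x * (\<Sum>i\<in>I. c i * indicator (A i) x) \<partial>M)"
    and "integrable M (\<lambda>x. f x * (\<Sum>i\<in>I. c i * indicator (A i) x))"
proof -
  have int: "integrable M (\<lambda>x. f x * indicator (A i) x)" if "i \<in> I" for i
    using integrable_mult_indicator[OF A[OF that] f] by (simp add: mult.commute)
  have eq: "(\<lambda>x. f x * (\<Sum>i\<in>I. c i * indicator (A i) x))
    = (\<lambda>x. \<Sum>i\<in>I. c i * (f x * indicator (A i) x))"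
    by (simp add: sum_distrib_left mult.left_commute)
  show "(\<Sum>i\<in>I. c i * (\<integral>x. f x * indicator (A i) x \<partial>M))
    = (\<integral>x. f x * (\<Sum>i\<in>I. c i * indicator (A i) x) \<partial>M)"
    unfolding eq using int by (subst Bochner_Integration.integral_sum) auto
  show "integrable M (\<lambda>x. f x * (\<Sum>i\<in>I. c i * indicator (A i) x))"
    unfolding eq using int by (intro Bochner_Integration.integrable_sum integrable_mult_right) auto
qed

lemma measure_density_eq_integral:
  fixes g :: "'a \<Rightarrow> real"
  assumes "g \<in> borel_measurable M" "\<And>x. 0 \<le> g x" "E \<in> sets M"
  shows "measure (density M (\<lambda>x. ennreal (g x))) E = (\<integral>x. g x * indicator E x \<partial>M)"
proof -
  note [measurable] = assms(1,3)
  have "emeasure (density M (\<lambda>x. ennreal (g x))) E = (\<integral>\<^sup>+x. ennreal (g x * indicator E x) \<partial>M)"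
    by (subst emeasure_density) (auto intro!: nn_integral_cong simp: indicator_def)
  then show ?thesis
    using assms(2) by (subst integral_eq_nn_integral) (auto simp: measure_def)
qed

lemma prob_density_integral:
  fixes g :: "'a \<Rightarrow> real"
  assumes [measurable]: "g \<in> borel_measurable M" and g: "\<And>x. 0 \<le> g x"
    and P: "prob_space (density M (\<lambda>x. ennreal (g x)))"
  shows "integrable M g" "(\<integral>x. g x \<partial>M) = 1"
proof -
  have *: "(\<integral>\<^sup>+x. ennreal (g x) \<partial>M) = 1"
    using prob_space.emeasure_space_1[OF P] by (simp add: emeasure_density cong: nn_integral_cong_simp)
  then show "integrable M g" using g by (intro integrableI_nonneg) auto
  show "(\<integral>x. g x \<partial>M) = 1" using g by (subst integral_eq_nn_integral) (auto simp: *)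
qed

lemma sum_indicator_partition_on:
  assumes "partition_on S \<E>" "finite \<E>" "x \<in> S"
  shows "(\<Sum>E\<in>\<E>. indicator E x) = (1 :: real)"
proof -
  obtain E where E: "E \<in> \<E>" "x \<in> E"
    using assms by (auto simp: partition_on_def)
  have "indicator E' x = (if E' = E then 1 else 0 :: real)" if "E' \<in> \<E>" for E'
    using E that assms(1) by (auto simp: partition_on_def disjoint_def indicator_def)
  then show ?thesis using E assms(2) by simp
qed

text \<open>The positive parts of \<open>g - 1\<close> and \<open>1 - g\<close> are approximated
  from below by simple functions \<open>U\<close> and \<open>V\<close>. Then
  \<open>1 + U - V\<close> starts from \<open>1\<close> instead of \<open>0\<close> and never leaves
  the interval between \<open>1\<close> and \<open>g\<close>, as \<open>dual_entropy_nonneg\<close>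
  requires.\<close>

lemma simple_approx_towards_one:
  fixes g :: "'a \<Rightarrow> real"
  assumes [measurable]: "g \<in> borel_measurable M" and "\<And>x. 0 \<le> g x"
  obtains t where "\<And>k. simple_function M (t k :: 'a \<Rightarrow> real)" "\<And>x. (\<lambda>k. t k x) \<longlonglongrightarrow> g x"
    "\<And>k x. 1 \<le> g x \<Longrightarrow> 1 \<le> t k x \<and> t k x \<le> g x"
    "\<And>k x. g x < 1 \<Longrightarrow> g x \<le> t k x \<and> t k x \<le> 1"
proof -
  have "\<exists>U. (\<forall>k. simple_function M (U k)) \<and> (\<forall>k x. 0 \<le> U k x \<and> U k x \<le> u x)
      \<and> (\<forall>x. (\<lambda>k. U k x) \<longlonglongrightarrow> u x)"
    if u[measurable]: "u \<in> borel_measurable M" "\<And>x. 0 \<le> u x" for u :: "'a \<Rightarrow> real"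
  proof -
    have "(\<lambda>x. ennreal (u x)) \<in> borel_measurable M" by simp
    from borel_measurable_implies_simple_function_sequence'[OF this]
    obtain f where f: "\<And>i. simple_function M (f i)" "incseq f" "\<And>i x. f i x < top"
      "\<And>x. (SUP i. f i x) = ennreal (u x)"
      by blast
    have le: "f i x \<le> ennreal (u x)" for i x
      unfolding f(4)[symmetric] by (rule SUP_upper) simp
    have "(\<lambda>i. f i x) \<longlonglongrightarrow> ennreal (u x)" for x
      unfolding f(4)[symmetric] using f(2) by (intro LIMSEQ_SUP) (auto simp: incseq_def le_fun_def)
    then have "(\<lambda>i. enn2real (f i x)) \<longlonglongrightarrow> u x" for x
      using tendsto_enn2real u(2) by blast
    moreover have "enn2real (f i x) \<le> u x" for i x
      using enn2real_mono[OF le[of i x]] u(2)[of x] by simp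
    ultimately show ?thesis
      using f(1) by (intro exI[of _ "\<lambda>i x. enn2real (f i x)"])
        (auto intro: simple_function_compose2 simple_function_compose1)
  qed
  note ex = this
  obtain U where U: "\<And>k. simple_function M (U k)" "\<And>k x. 0 \<le> U k x \<and> U k x \<le> max 0 (g x - 1)"
    "\<And>x. (\<lambda>k. U k x) \<longlonglongrightarrow> max 0 (g x - 1)"
    using ex[of "\<lambda>x. max 0 (g x - 1)"] by auto
  obtain V where V: "\<And>k. simple_function M (V k)" "\<And>k x. 0 \<le> V k x \<and> V k x \<le> max 0 (1 - g x)"
    "\<And>x. (\<lambda>k. V k x) \<longlonglongrightarrow> max 0 (1 - g x)"
    using ex[of "\<lambda>x. max 0 (1 - g x)"] by auto
  show ?thesis
  \<comment> \<open>At every point at most one of \<open>U\<close> and \<open>V\<close> is nonzero,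
    because the two positive parts have disjoint supports.\<close>
  proof (rule that[of "\<lambda>k x. 1 + U k x - V k x"])
    show "simple_function M (\<lambda>x. 1 + U k x - V k x)" for k
      using U(1) V(1) by (intro simple_function_diff simple_function_add) auto
    show "(\<lambda>k. 1 + U k x - V k x) \<longlonglongrightarrow> g x" for x
    proof -
      have "(\<lambda>k. 1 + U k x - V k x) \<longlonglongrightarrow> 1 + max 0 (g x - 1) - max 0 (1 - g x)"
        by (intro tendsto_intros U V)
      also have "1 + max 0 (g x - 1) - max 0 (1 - g x) = g x" by auto
      finally show ?thesis .
    qed
    show "1 \<le> g x \<Longrightarrow> 1 \<le> 1 + U k x - V k x \<and> 1 + U k x - V k x \<le> g x" for k x
      using U(2)[of k x] V(2)[of k x] by auto
    show "g x < 1 \<Longrightarrow> g x \<le> 1 + U k x - V k x \<and> 1 + U k x - V k x \<le> 1" for k x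
      using U(2)[of k x] V(2)[of k x] by auto
  qed
qed

text \<open>From \<open>ln t \<ge> 1 - 1 / t\<close> the expression is at least
  \<open>(t - 1) * (a - t) / t\<close>, and both factors have the same sign when \<open>t\<close>
  lies between \<open>1\<close> and \<open>a\<close>. For \<open>t = 0\<close> the hypotheses force
  \<open>a = 0\<close>.\<close>

lemma dual_entropy_nonneg:
  fixes a t :: real
  assumes "0 \<le> a" "1 \<le> t \<and> t \<le> a \<or> a \<le> t \<and> t \<le> 1"
  shows "0 \<le> a * ln t - t + 1"
proof (cases "t = 0")
  case False
  then have "0 < t" using assms by auto
  then have "a * (1 - 1 / t) \<le> a * ln t"
    using assms(1) ln_le_minus_one[of "1 / t"] by (intro mult_left_mono) (auto simp: ln_div)
  moreover have "0 \<le> (t - 1) * (a - t) / t"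
    using assms \<open>0 < t\<close> by (auto simp: zero_le_mult_iff)
  then have "0 \<le> a * (1 - 1 / t) - t + 1"
    using \<open>0 < t\<close> by (simp add: field_simps)
  ultimately show ?thesis by linarith
qed (use assms in auto)

text \<open>On a cell \<open>E\<close>, \<open>ln_mult_le\<close> is integrated with constant
  \<open>t\<close>; the best choice \<open>t = P(E) / Q(E)\<close> bounds the entropy term by the
  integral of \<open>h\<close> over \<open>E\<close> plus \<open>P(E) - Q(E)\<close>. Summing over
  the partition cancels the masses. This is Jensen's inequality, cell by cell.\<close>

lemma rel_entropy_density_le:
  fixes g :: "'a \<Rightarrow> real"
  assumes "prob_space Q" and [measurable]: "g \<in> borel_measurable Q" and g: "\<And>x. 0 \<le> g x"
    and P: "prob_space (density Q (\<lambda>x. ennreal (g x)))"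
  shows "rel_entropy Q (density Q (\<lambda>x. ennreal (g x)))
    \<le> enn2ereal (\<integral>\<^sup>+x. ennreal (g x * ln (g x) - g x + 1) \<partial>Q)"
proof -
  interpret Q: prob_space Q by fact
  let ?P = "density Q (\<lambda>x. ennreal (g x))"
  note intg = prob_density_integral[OF assms(2) g P]
  have Pm: "measure ?P E = (\<integral>x. g x * indicator E x \<partial>Q)" if "E \<in> sets Q" for E
    using measure_density_eq_integral[OF assms(2) g that] by simp
  define h where "h x = g x * ln (g x) - g x + 1" for x
  have h: "0 \<le> h x" for x
    using ln_mult_le[OF g[of x], of 1] by (simp add: h_def)
  have [measurable]: "h \<in> borel_measurable Q" unfolding h_def by measurable
  show ?thesis
  proof (cases "(\<integral>\<^sup>+x. ennreal (h x) \<partial>Q) = \<infinity>")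
    case False
    then have inth: "integrable Q h"
      using h by (intro integrableI_nonneg) (auto simp: less_top)
    have bound: "measure ?P E * ln (measure ?P E / measure Q E)
        \<le> (\<integral>x. h x * indicator E x \<partial>Q) + measure ?P E - measure Q E"
      if E: "E \<in> sets Q" for E
    proof -
      have *: "measure ?P E * ln t - t * measure Q E + measure Q E \<le> (\<integral>x. h x * indicator E x \<partial>Q)"
        if "0 < t" for t
      proof -
        have ig: "integrable Q (\<lambda>x. g x * indicator E x)"
          using integrable_mult_indicator[OF E intg(1)] by (simp add: mult.commute)
        have ih: "integrable Q (\<lambda>x. h x * indicator E x)"
          using integrable_mult_indicator[OF E inth] by (simp add: mult.commute)
        have ii: "integrable Q (indicator E :: 'a \<Rightarrow> real)"
          using E by (simp add: Q.emeasure_eq_measure)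
        have "(\<integral>x. ln t * (g x * indicator E x) - (t - 1) * indicator E x \<partial>Q)
          \<le> (\<integral>x. h x * indicator E x \<partial>Q)"
        proof (rule integral_mono)
          show "integrable Q (\<lambda>x. ln t * (g x * indicator E x) - (t - 1) * indicator E x)"
            using ig ii by simp
          show "ln t * (g x * indicator E x) - (t - 1) * indicator E x \<le> h x * indicator E x" for x
            using ln_mult_le[OF g \<open>0 < t\<close>, of x] by (simp add: h_def indicator_def algebra_simps)
        qed (rule ih)
        also have "(\<integral>x. ln t * (g x * indicator E x) - (t - 1) * indicator E x \<partial>Q)
          = measure ?P E * ln t - t * measure Q E + measure Q E"
          using ig ii E by (simp add: Pm algebra_simps)
        finally show ?thesis .
      qed
      show ?thesis
      proof (cases "measure ?P E = 0")
        case True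
        \<comment> \<open>The optimal \<open>t\<close> would be \<open>0\<close>, which is not
          allowed; it is approached by arbitrarily small \<open>e > 0\<close>.\<close>
        have "measure Q E \<le> (\<integral>x. h x * indicator E x \<partial>Q)"
        proof (rule field_le_epsilon)
          fix e :: real assume "0 < e"
          then have "e * measure Q E \<le> e * 1" by (intro mult_left_mono) auto
          with *[OF \<open>0 < e\<close>] True show "measure Q E \<le> (\<integral>x. h x * indicator E x \<partial>Q) + e"
            by simp
        qed
        then show ?thesis using True by simp
      next
        case False
        have ac: "absolutely_continuous Q ?P"
          by (intro absolutely_continuousI_density) simp
        have "0 < measure Q E"
          using absolutely_continuous_measure_eq_0[OF ac _ E] False assms(1)
          by (auto simp: less_le)
        moreover have "0 < measure ?P E" using False by (simp add: less_le)
        ultimately show ?thesis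
          using *[of "measure ?P E / measure Q E"] by simp
      qed
    qed
    show ?thesis
      unfolding rel_entropy_def
    proof (rule SUP_least, clarify)
      fix \<E> assume \<E>: "finite \<E>" "\<E> \<subseteq> sets Q" "partition_on (space Q) \<E>"
      have E[simp]: "E \<in> sets Q" if "E \<in> \<E>" for E using \<E> that by auto
      have ac: "absolutely_continuous Q ?P"
        by (intro absolutely_continuousI_density) simp
      have one: "(\<integral>x. f x * (\<Sum>E\<in>\<E>. 1 * indicator E x) \<partial>Q) = integral\<^sup>L Q f" for f :: "'a \<Rightarrow> real"
        using sum_indicator_partition_on[OF \<E>(3,1)]
        by (intro Bochner_Integration.integral_cong) auto
      have tot: "(\<Sum>E\<in>\<E>. \<integral>x. f x * indicator E x \<partial>Q) = integral\<^sup>L Q f"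
        if "integrable Q f" for f :: "'a \<Rightarrow> real"
        using sum_measure_mult_eq_integral(1)[OF that, where I = \<E> and A = "\<lambda>E. E" and c = "\<lambda>_. 1"] one[of f] by simp
      have "(\<Sum>E\<in>\<E>. entropy_term (measure ?P E) (measure Q E))
        = ereal (\<Sum>E\<in>\<E>. measure ?P E * ln (measure ?P E / measure Q E))"
        using absolutely_continuous_measure_eq_0[OF ac assms(1)]
        by (simp add: entropy_term_ereal)
      also have "\<dots> \<le> ereal (\<Sum>E\<in>\<E>. (\<integral>x. h x * indicator E x \<partial>Q) + measure ?P E - measure Q E)"
        using bound by (auto intro!: sum_mono)
      also have "(\<Sum>E\<in>\<E>. (\<integral>x. h x * indicator E x \<partial>Q) + measure ?P E - measure Q E) = integral\<^sup>L Q h"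
      proof -
        have "(\<Sum>E\<in>\<E>. measure ?P E) = 1"
          using tot[OF intg(1)] by (simp add: Pm intg(2))
        moreover have "(\<Sum>E\<in>\<E>. measure Q E) = 1"
          using tot[of "\<lambda>_. 1"] by (simp add: Q.prob_space)
        ultimately show ?thesis
          by (simp add: sum.distrib sum_subtractf tot[OF inth])
      qed
      also have "ereal (integral\<^sup>L Q h) = enn2ereal (\<integral>\<^sup>+x. ennreal (h x) \<partial>Q)"
        using nn_integral_eq_integral[OF inth] h by (simp add: enn2ereal_ennreal integral_nonneg_AE)
      finally show "(\<Sum>E\<in>\<E>. entropy_term (measure ?P E) (measure Q E))
        \<le> enn2ereal (\<integral>\<^sup>+x. ennreal (g x * ln (g x) - g x + 1) \<partial>Q)"
        by (simp add: h_def)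
    qed
  qed (simp add: h_def)
qed

text \<open>
  Gibbs' inequality on the level sets of a simple function \<open>t \<ge> 0\<close> bounds the relative entropy below
  by the integral of \<open>g ln t - t + 1\<close>. If \<open>t\<close> lies between \<open>1\<close> and \<open>g\<close>, this integrand is
  nonnegative, so Fatou's lemma applies as \<open>t\<close> tends to \<open>g\<close>.
\<close>

lemma rel_entropy_density_ge:
  fixes g :: "'a \<Rightarrow> real"
  assumes "prob_space Q" and [measurable]: "g \<in> borel_measurable Q" and g: "\<And>x. 0 \<le> g x"
    and P: "prob_space (density Q (\<lambda>x. ennreal (g x)))"
  shows "enn2ereal (\<integral>\<^sup>+x. ennreal (g x * ln (g x) - g x + 1) \<partial>Q)
    \<le> rel_entropy Q (density Q (\<lambda>x. ennreal (g x)))"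
proof -
  interpret Q: prob_space Q by fact
  let ?P = "density Q (\<lambda>x. ennreal (g x))"
  note intg = prob_density_integral[OF assms(2) g P]
  have Pm: "measure ?P E = (\<integral>x. g x * indicator E x \<partial>Q)" if "E \<in> sets Q" for E
    using measure_density_eq_integral[OF assms(2) g that] by simp
  have ac: "absolutely_continuous Q ?P"
    by (intro absolutely_continuousI_density) simp
  obtain t where t: "\<And>k. simple_function Q (t k :: 'a \<Rightarrow> real)" "\<And>x. (\<lambda>k. t k x) \<longlonglongrightarrow> g x"
    "\<And>k x. 1 \<le> g x \<Longrightarrow> 1 \<le> t k x \<and> t k x \<le> g x"
    "\<And>k x. g x < 1 \<Longrightarrow> g x \<le> t k x \<and> t k x \<le> 1"
    using simple_approx_towards_one[OF assms(2) g] by blast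
  have [measurable]: "t k \<in> borel_measurable Q" for k
    using t(1) by (rule borel_measurable_simple_function)
  define d where "d k x = g x * ln (t k x) - t k x + 1" for k x
  have d: "0 \<le> d k x" for k x
    unfolding d_def using t(3,4)[of x k] g[of x] by (intro dual_entropy_nonneg) linarith+
  have t_nonneg: "0 \<le> t k x" for k x
    using t(3,4)[of x k] g[of x] by linarith
  have t0: "g x = 0" if "t k x = 0" for k x
    using t(3,4)[of x k] g[of x] that by linarith
  have [measurable]: "d k \<in> borel_measurable Q" for k unfolding d_def by measurable
  have le: "enn2ereal (\<integral>\<^sup>+x. ennreal (d k x) \<partial>Q) \<le> rel_entropy Q ?P" for k
  proof -
    define I where "I = t k ` space Q"
    define A where "A c = t k -` {c} \<inter> space Q" for c
    have I: "finite I" using t(1) by (auto simp: I_def dest: simple_functionD)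
    have A[measurable]: "A c \<in> sets Q" for c by (simp add: A_def)
    have ind: "(\<Sum>c\<in>I. f c * indicator (A c) x) = f (t k x)" if "x \<in> space Q" for x and f :: "real \<Rightarrow> real"
    proof -
      have "(\<Sum>c\<in>I. f c * indicator (A c) x) = (\<Sum>c\<in>I. if c = t k x then f c else 0)"
        using that by (intro sum.cong) (auto simp: A_def indicator_def)
      also have "\<dots> = f (t k x)" using that I by (simp add: I_def)
      finally show ?thesis .
    qed
    have sum_eq: "(\<Sum>c\<in>I. f c * (\<integral>x. u x * indicator (A c) x \<partial>Q)) = (\<integral>x. u x * f (t k x) \<partial>Q)"
      if "integrable Q u" for u and f :: "real \<Rightarrow> real"
      using sum_measure_mult_eq_integral(1)[OF that, where A = A and I = I and c = f] A
      by (simp add: ind cong: Bochner_Integration.integral_cong)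
    have int: "integrable Q (\<lambda>x. u x * f (t k x))" if "integrable Q u" for u and f :: "real \<Rightarrow> real"
      using sum_measure_mult_eq_integral(2)[OF that, where A = A and I = I and c = f] A
      by (simp add: ind cong: Bochner_Integration.integrable_cong)
    have int_one: "integrable Q (t k)" using int[of "\<lambda>_. 1" "\<lambda>x. x"] by simp
    have intd: "integrable Q (d k)"
      unfolding d_def using int[OF intg(1), of ln] int_one by simp
    have p_eq: "(\<integral>x. g x * indicator (A c) x \<partial>Q) = measure ?P (A c)" for c by (simp add: Pm)
    have bound: "measure ?P (A c) * ln c - c * measure Q (A c) + measure ?P (A c)
      \<le> measure ?P (A c) * ln (measure ?P (A c) / measure Q (A c))" if "c \<in> I" for c
    proof (cases "measure ?P (A c) = 0")
      case False
      \<comment> \<open>Where \<open>t k\<close> vanishes so does \<open>g\<close>, by the position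
        of \<open>t k\<close> between \<open>1\<close> and \<open>g\<close>; hence the level set of
        \<open>0\<close> carries no mass of \<open>?P\<close>.\<close>
      have "c \<noteq> 0"
      proof
        assume "c = 0"
        then have "(\<lambda>x. g x * indicator (A c) x) = (\<lambda>_. 0)"
          using t0[of k] by (auto simp: A_def indicator_def fun_eq_iff)
        then show False using False by (simp add: Pm)
      qed
      then have "0 < c" using that t_nonneg by (auto simp: I_def less_le)
      have "0 < measure Q (A c)"
        using absolutely_continuous_measure_eq_0[OF ac assms(1) A] False
        by (auto simp: less_le)
      moreover have "0 < measure ?P (A c)" using False by (simp add: less_le)
      \<comment> \<open>The comparison value \<open>c * measure Q (A c)\<close> is the mass the
        level set would have if the density were \<open>c\<close> on it.\<close>
      moreover have "measure ?P (A c) - c * measure Q (A c)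
        \<le> measure ?P (A c) * ln (measure ?P (A c) / (c * measure Q (A c)))"
        using \<open>0 < c\<close> calculation by (intro mult_ln_div_ge) auto
      ultimately show ?thesis
        using \<open>0 < c\<close> by (simp add: ln_div ln_mult algebra_simps)
    next
      case True
      then show ?thesis using that t_nonneg by (auto simp: I_def)
    qed
    have "(\<integral>x. d k x \<partial>Q) = (\<integral>x. g x * ln (t k x) \<partial>Q) - (\<integral>x. t k x \<partial>Q) + 1"
      unfolding d_def using int[OF intg(1), of ln] int_one by (simp add: Q.prob_space)
    also have "\<dots> = (\<Sum>c\<in>I. measure ?P (A c) * ln c - c * measure Q (A c) + measure ?P (A c))"
    proof -
      have "(\<Sum>c\<in>I. measure ?P (A c) * ln c) = (\<integral>x. g x * ln (t k x) \<partial>Q)"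
        using sum_eq[OF intg(1), of ln] by (simp add: p_eq mult.commute)
      moreover have "(\<Sum>c\<in>I. c * measure Q (A c)) = (\<integral>x. t k x \<partial>Q)"
        using sum_eq[of "\<lambda>_. 1" "\<lambda>x. x"] by simp
      moreover have "(\<Sum>c\<in>I. measure ?P (A c)) = 1"
        using sum_eq[OF intg(1), of "\<lambda>_. 1"] by (simp add: p_eq intg(2))
      ultimately show ?thesis by (simp add: sum.distrib sum_subtractf)
    qed
    also have "\<dots> \<le> (\<Sum>c\<in>I. measure ?P (A c) * ln (measure ?P (A c) / measure Q (A c)))"
      by (intro sum_mono bound)
    finally have "ereal (\<integral>x. d k x \<partial>Q)
      \<le> (\<Sum>c\<in>I. entropy_term (measure ?P (A c)) (measure Q (A c)))"
      using absolutely_continuous_measure_eq_0[OF ac assms(1) A]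
      by (simp add: entropy_term_ereal)
    also have "\<dots> \<le> rel_entropy Q ?P"
      using I by (intro sum_entropy_term_le_rel_entropy)
        (auto simp: A_def I_def disjoint_family_on_def)
    finally show ?thesis
      using nn_integral_eq_integral[OF intd] d by (simp add: enn2ereal_ennreal integral_nonneg_AE)
  qed
  have le': "(\<integral>\<^sup>+x. ennreal (d k x) \<partial>Q) \<le> e2ennreal (rel_entropy Q ?P)" for k
    using e2ennreal_mono[OF le[of k]] by simp
  have lim: "(\<lambda>k. ennreal (d k x)) \<longlonglongrightarrow> ennreal (g x * ln (g x) - g x + 1)" for x
  proof (intro tendsto_ennrealI)
    \<comment> \<open>Where \<open>g x > 0\<close>, \<open>ln\<close> is continuous at
      \<open>g x\<close>. Where \<open>g x = 0\<close>, the logarithms need not converge, but their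
      coefficient is \<open>0\<close>.\<close>
    show "(\<lambda>k. d k x) \<longlonglongrightarrow> g x * ln (g x) - g x + 1"
      unfolding d_def using t(2)[of x]
      by (cases "g x = 0") (auto intro!: tendsto_eq_intros)
  qed
  have "(\<integral>\<^sup>+x. ennreal (g x * ln (g x) - g x + 1) \<partial>Q) = (\<integral>\<^sup>+x. liminf (\<lambda>k. ennreal (d k x)) \<partial>Q)"
    by (intro nn_integral_cong lim_imp_Liminf[OF _ lim, symmetric]) simp
  also have "\<dots> \<le> liminf (\<lambda>k. \<integral>\<^sup>+x. ennreal (d k x) \<partial>Q)"
    by (intro nn_integral_liminf) simp
  also have "\<dots> \<le> e2ennreal (rel_entropy Q ?P)"
    by (intro Liminf_le always_eventually allI le') simp
  finally have "enn2ereal (\<integral>\<^sup>+x. ennreal (g x * ln (g x) - g x + 1) \<partial>Q)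
    \<le> enn2ereal (e2ennreal (rel_entropy Q ?P))"
    by (simp add: less_eq_ennreal.rep_eq)
  also have "\<dots> = rel_entropy Q ?P"
    using rel_entropy_nonneg[OF P assms(1)] by (intro enn2ereal_e2ennreal) simp
  finally show ?thesis .
qed

lemma rel_entropy_density:
  fixes g :: "'a \<Rightarrow> real"
  assumes "prob_space Q" "g \<in> borel_measurable Q" "\<And>x. 0 \<le> g x"
    and "prob_space (density Q (\<lambda>x. ennreal (g x)))"
  shows "rel_entropy Q (density Q (\<lambda>x. ennreal (g x)))
    = enn2ereal (\<integral>\<^sup>+x. ennreal (g x * ln (g x) - g x + 1) \<partial>Q)"
  using rel_entropy_density_le[OF assms] rel_entropy_density_ge[OF assms] by (rule antisym)

subsection \<open>Fekete's lemma\<close>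

text \<open>Superadditivity peels off \<open>q\<close> blocks of length \<open>k\<close>, and
  nonnegativity discards the remainder. It also keeps the scalar multiples distributive when
  \<open>a k = \<infinity>\<close>.\<close>

lemma superadditive_mult_le:
  fixes a :: "nat \<Rightarrow> ereal"
  assumes "\<And>n. 0 \<le> a n" and "\<And>n m. a n + a m \<le> a (n + m)"
  shows "ereal (real q) * a k \<le> a (q * k + r)"
proof (induction q)
  case (Suc q)
  have "ereal (real (Suc q)) * a k = a k + ereal (real q) * a k"
    using assms(1)[of k] by (cases "a k") (auto simp: algebra_simps)
  also have "\<dots> \<le> a k + a (q * k + r)" by (intro add_left_mono Suc.IH)
  also have "\<dots> \<le> a (Suc q * k + r)" using assms(2)[of k "q * k + r"] by (simp add: add.assoc)
  finally show ?case .
qed (use assms(1) in \<open>simp flip: zero_ereal_def\<close>)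

text \<open>The supremum bounds every term with \<open>n \<ge> 1\<close>. For any \<open>z\<close>
  below it, one \<open>k\<close> with \<open>a k / k > z\<close> controls all large \<open>n\<close>
  through division by \<open>k\<close>. Working with order neighbourhoods treats an infinite
  supremum alike.\<close>

lemma superadditive_tendsto_SUP:
  fixes a :: "nat \<Rightarrow> ereal"
  assumes nonneg: "\<And>n. 0 \<le> a n" and super: "\<And>n m. a n + a m \<le> a (n + m)"
  shows "(\<lambda>n. ereal (1 / real n) * a n) \<longlonglongrightarrow> (SUP k\<in>{1..}. ereal (1 / real k) * a k)"
proof (rule order_tendstoI)
  fix z assume "z < (SUP k\<in>{1..}. ereal (1 / real k) * a k)"
  then obtain k where k: "1 \<le> k" "z < ereal (1 / real k) * a k"
    by (auto simp: less_SUP_iff)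
  \<comment> \<open>As \<open>n div k \<ge> n / k - 1\<close>, the coefficient
    \<open>(n div k) / n\<close> of \<open>a k\<close> is at least \<open>1 / k - 1 / n\<close>. Its
    limit is nonzero, so the product converges even if \<open>a k = \<infinity>\<close>.\<close>
  have "(\<lambda>n. 1 / real k - 1 / real n) \<longlonglongrightarrow> 1 / real k - 0"
    by (intro tendsto_intros lim_1_over_n)
  then have "(\<lambda>n. ereal (1 / real k - 1 / real n) * a k) \<longlonglongrightarrow> ereal (1 / real k) * a k"
    using k(1) by (intro tendsto_mult_ereal) (auto simp: zero_ereal_def)
  then have "eventually (\<lambda>n. z < ereal (1 / real k - 1 / real n) * a k) sequentially"
    using k(2) by (rule order_tendstoD)
  then show "eventually (\<lambda>n. z < ereal (1 / real n) * a n) sequentially"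
    using eventually_gt_at_top[of 0]
  proof eventually_elim
    case (elim n)
    have "real n = real (n div k) * real k + real (n mod k)"
      by (metis div_mult_mod_eq of_nat_add of_nat_mult)
    moreover have "real (n mod k) \<le> real k" using k(1) by simp
    ultimately have "real n - real k \<le> real (n div k) * real k" by linarith
    then have "(real n - real k) / (real k * real n) \<le> real (n div k) * real k / (real k * real n)"
      by (intro divide_right_mono) auto
    then have "1 / real k - 1 / real n \<le> 1 / real n * real (n div k)"
      using k(1) elim(2) by (simp add: diff_divide_distrib)
    then have "ereal (1 / real k - 1 / real n) * a k \<le> ereal (1 / real n * real (n div k)) * a k"
      using nonneg by (intro ereal_mult_right_mono) auto
    also have "\<dots> = ereal (1 / real n) * (ereal (real (n div k)) * a k)"
      by (simp flip: mult.assoc)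
    also have "\<dots> \<le> ereal (1 / real n) * a (n div k * k + n mod k)"
      by (intro ereal_mult_left_mono superadditive_mult_le assms) auto
    finally show ?case using elim(1) by simp
  qed
next
  fix z assume z: "(SUP k\<in>{1..}. ereal (1 / real k) * a k) < z"
  have "ereal (1 / real n) * a n \<le> (SUP k\<in>{1..}. ereal (1 / real k) * a k)" if "1 \<le> n" for n
    using that by (intro SUP_upper) auto
  then show "eventually (\<lambda>n. ereal (1 / real n) * a n < z) sequentially"
    using z by (auto simp: eventually_sequentially intro: le_less_trans)
qed

subsection \<open>Laws of blocks\<close>

definition gauss_density :: "nat \<Rightarrow> (nat \<Rightarrow> real) \<Rightarrow> real" where
  "gauss_density n x = (\<Prod>i<n. std_normal_density (x i))"

abbreviation gauss_measure :: "nat \<Rightarrow> (nat \<Rightarrow> real) measure" where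
  "gauss_measure n \<equiv> density (leb n) (\<lambda>x. ennreal (gauss_density n x))"

lemma sets_leb [measurable_cong]: "sets (leb n) = sets (Pi\<^sub>M {..<n} (\<lambda>_. borel))"
  unfolding leb_def by (intro sets_PiM_cong) auto

lemma sets_block_law [measurable_cong, simp]:
  "sets (block_law M X n) = sets (Pi\<^sub>M {..<n} (\<lambda>_. borel))"
  by (simp add: block_law_def)

lemma space_block_law [simp]:
  "space (block_law M X n) = space (Pi\<^sub>M {..<n} (\<lambda>_. borel))"
  by (simp add: block_law_def)

lemma sets_process_law [simp]: "sets (process_law M X) = sets (Pi\<^sub>M UNIV (\<lambda>_. borel))"
  by (simp add: process_law_def)

lemma measurable_gauss_density [measurable]: "gauss_density n \<in> borel_measurable (leb n)"
  unfolding gauss_density_def[abs_def] measurable_cong_sets[OF sets_leb refl]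
proof (rule borel_measurable_prod)
  fix i assume "i \<in> {..<n}"
  then have [measurable]: "(\<lambda>x. x i) \<in> borel_measurable (Pi\<^sub>M {..<n} (\<lambda>_. borel :: real measure))"
    by (rule measurable_component_singleton)
  show "(\<lambda>x. std_normal_density (x i)) \<in> borel_measurable (Pi\<^sub>M {..<n} (\<lambda>_. borel))"
    by measurable
qed

lemma sigma_finite_leb: "sigma_finite_measure (leb n)"
proof -
  interpret finite_product_sigma_finite "\<lambda>_. lborel :: real measure" "{..<n}"
    by standard auto
  show ?thesis by (simp add: leb_def sigma_finite_measure_axioms)
qed

lemma measurable_block [measurable]:
  assumes "\<And>i. X i \<in> borel_measurable M"
  shows "(\<lambda>\<omega>. \<lambda>i\<in>I. X i \<omega>) \<in> M \<rightarrow>\<^sub>M Pi\<^sub>M I (\<lambda>_. borel)"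
  using assms by (intro measurable_restrict) auto

lemma measurable_coordinates:
  assumes "f \<in> J \<rightarrow> I"
  shows "(\<lambda>x. \<lambda>i\<in>J. x (f i)) \<in> Pi\<^sub>M I (\<lambda>_. M) \<rightarrow>\<^sub>M Pi\<^sub>M J (\<lambda>_. M)"
  using assms by (intro measurable_restrict measurable_component_singleton) auto

lemma prob_space_block_law:
  assumes "prob_space M" "\<And>i. X i \<in> borel_measurable M"
  shows "prob_space (block_law M X n)"
  unfolding block_law_def using assms by (intro prob_space.prob_space_distr measurable_block)

text \<open>Boxes determine a product measure. On a box the density and the indicator both factor
  over the coordinates, so the integral is a product of one-dimensional ones.\<close>

lemma gauss_measure_eq_PiM:
  "gauss_measure n = Pi\<^sub>M {..<n} (\<lambda>_. density lborel (\<lambda>x. ennreal (std_normal_density x)))"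
    (is "_ = Pi\<^sub>M _ (\<lambda>_. ?D)")
proof -
  interpret L: product_sigma_finite "\<lambda>_::nat. lborel :: real measure" by standard
  interpret prob_space ?D by (rule prob_space_normal_density) simp
  interpret D: product_sigma_finite "\<lambda>_::nat. ?D" by standard
  show ?thesis
  proof (rule D.PiM_eqI)
    show "sets (gauss_measure n) = sets (Pi\<^sub>M {..<n} (\<lambda>_. ?D))"
      unfolding sets_density leb_def by (intro sets_PiM_cong) auto
    fix A :: "nat \<Rightarrow> real set" assume "\<And>i. i \<in> {..<n} \<Longrightarrow> A i \<in> sets ?D"
    then have A[measurable]: "A i \<in> sets borel" if "i < n" for i using that by simp
    have PA: "Pi\<^sub>E {..<n} A \<in> sets (leb n)"
      unfolding sets_leb using A by (intro sets_PiM_I_finite) auto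
    have "emeasure (gauss_measure n) (Pi\<^sub>E {..<n} A)
      = (\<integral>\<^sup>+x. ennreal (gauss_density n x) * indicator (Pi\<^sub>E {..<n} A) x \<partial>leb n)"
      using PA by (intro emeasure_density) simp_all
    also have "\<dots> = (\<integral>\<^sup>+x. (\<Prod>i<n. ennreal (std_normal_density (x i)) * indicator (A i) (x i)) \<partial>leb n)"
    proof (rule nn_integral_cong)
      fix x assume "x \<in> space (leb n)"
      \<comment> \<open>The indicator of an extensional box is the product of coordinate indicators
        only at extensional points.\<close>
      then have "x \<in> extensional {..<n}" by (simp add: leb_def space_PiM PiE_def)
      then have "indicator (Pi\<^sub>E {..<n} A) x = (\<Prod>i<n. indicator (A i) (x i) :: ennreal)"
        by (auto simp: indicator_def PiE_def Pi_def intro!: prod.neutral)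
      then show "ennreal (gauss_density n x) * indicator (Pi\<^sub>E {..<n} A) x
        = (\<Prod>i<n. ennreal (std_normal_density (x i)) * indicator (A i) (x i))"
        by (simp add: gauss_density_def prod.distrib prod_ennreal)
    qed
    also have "\<dots> = (\<Prod>i<n. \<integral>\<^sup>+y. ennreal (std_normal_density y) * indicator (A i) y \<partial>lborel)"
      unfolding leb_def by (intro L.product_nn_integral_prod) auto
    also have "\<dots> = (\<Prod>i<n. emeasure ?D (A i))"
      by (intro prod.cong refl emeasure_density[symmetric]) auto
    finally show "emeasure (gauss_measure n) (Pi\<^sub>E {..<n} A) = (\<Prod>i<n. emeasure ?D (A i))" .
  qed simp
qed

lemma prob_space_gauss_measure: "prob_space (gauss_measure n)"
  unfolding gauss_measure_eq_PiM by (intro prob_space_PiM prob_space_normal_density) simp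

lemma independent_gaussian_processD:
  assumes "independent_gaussian_process N \<eta>"
  shows "prob_space N" "prob_space.indep_vars N (\<lambda>_. borel) \<eta> UNIV" "\<eta> i \<in> borel_measurable N"
    "distr N borel (\<eta> i) = density lborel (\<lambda>x. ennreal (std_normal_density x))"
proof -
  have d: "distributed N lborel (\<eta> i) std_normal_density"
    using assms by (simp add: independent_gaussian_process_def)
  show "\<eta> i \<in> borel_measurable N"
    using distributed_measurable[OF d] by simp
  have "distr N borel (\<eta> i) = distr N lborel (\<eta> i)" by (intro distr_cong) auto
  then show "distr N borel (\<eta> i) = density lborel (\<lambda>x. ennreal (std_normal_density x))"
    using distributed_distr_eq_density[OF d] by simp
qed (use assms in \<open>simp_all add: independent_gaussian_process_def\<close>)

lemma block_law_gaussian: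
  assumes "independent_gaussian_process N \<eta>"
  shows "block_law N \<eta> n = gauss_measure n"
proof (cases "n = 0")
  case False
  note g = independent_gaussian_processD[OF assms]
  interpret N: prob_space N by (rule g(1))
  have "N.indep_vars (\<lambda>_. borel) \<eta> {..<n}"
    using g(2) by (rule N.indep_vars_subset) simp
  then have "distr N (Pi\<^sub>M {..<n} (\<lambda>_. borel)) (\<lambda>x. \<lambda>i\<in>{..<n}. \<eta> i x)
      = Pi\<^sub>M {..<n} (\<lambda>i. distr N borel (\<eta> i))"
    using False g(3) by (subst (asm) N.indep_vars_iff_distr_eq_PiM) auto
  then show ?thesis
    by (simp add: block_law_def gauss_measure_eq_PiM g(4))
next
  \<comment> \<open>The description of independence by product laws is applied to nonempty index
    sets. For \<open>n = 0\<close> both sides are probability measures on a one-point space.\<close>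
  case True
  interpret P: prob_space "block_law N \<eta> n"
    using independent_gaussian_processD[OF assms] by (intro prob_space_block_law) auto
  interpret Q: prob_space "gauss_measure n" by (rule prob_space_gauss_measure)
  show ?thesis
  proof (rule measure_eqI)
    fix A assume "A \<in> sets (block_law N \<eta> n)"
    then have "A = {} \<or> A = {\<lambda>_. undefined}" using True by (simp add: sets_PiM_empty)
    moreover have "space (block_law N \<eta> n) = {\<lambda>_. undefined}" "space (gauss_measure n) = {\<lambda>_. undefined}"
      using True by (simp_all add: block_law_def leb_def space_PiM)
    ultimately show "emeasure (block_law N \<eta> n) A = emeasure (gauss_measure n) A"
      using P.emeasure_space_1 Q.emeasure_space_1 by auto
  qed (simp add: sets_leb)
qed

section \<open>Stationarity and marginals of blocks\<close>

lemma orbit_process_measurable: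
  assumes "dynamical_system M T" "F \<in> borel_measurable M"
  shows "orbit_process F T i \<in> borel_measurable M"
proof -
  have [measurable]: "T \<in> M \<rightarrow>\<^sub>M M" "F \<in> borel_measurable M"
    using assms by (auto dest: dynamical_system.measurable_T)
  show ?thesis unfolding orbit_process_def by measurable
qed

lemma distr_funpow_preserving:
  assumes "dynamical_system M T"
  shows "distr M M (T ^^ n) = M"
proof (induction n)
  case (Suc n)
  have [measurable]: "T \<in> M \<rightarrow>\<^sub>M M" using assms by (rule dynamical_system.measurable_T)
  have "distr M M (T ^^ Suc n) = distr (distr M M (T ^^ n)) M T"
    by (subst distr_distr) auto
  then show ?case unfolding Suc.IH dynamical_system.preserving_T[OF assms] .
qed (simp add: distr_id id_def)

text \<open>Stationarity: the shifted block is the original one composed with \<open>T ^^ n\<close>,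
  which preserves \<open>M\<close>.\<close>

lemma block_law_shift:
  assumes "dynamical_system M T" "F \<in> borel_measurable M"
  shows "block_law M (\<lambda>i. orbit_process F T (n + i)) m = block_law M (orbit_process F T) m"
proof -
  note X[measurable] = orbit_process_measurable[OF assms]
  have [measurable]: "T \<in> M \<rightarrow>\<^sub>M M" using assms(1) by (rule dynamical_system.measurable_T)
  have "block_law M (orbit_process F T) m = block_law (distr M M (T ^^ n)) (orbit_process F T) m"
    using distr_funpow_preserving[OF assms(1)] by simp
  also have "\<dots> = block_law M (\<lambda>i. orbit_process F T (n + i)) m"
    unfolding block_law_def
    by (subst distr_distr[OF measurable_block[OF X]])
      (auto simp: comp_def orbit_process_def funpow_add add.commute[of n] intro!: distr_cong)
  finally show ?thesis ..
qed

text \<open>This lemma and \<open>distr_block_law_shift\<close> identify the two marginals of an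
  \<open>(n + m)\<close>-block to which \<open>rel_entropy_superadditive\<close> is applied.\<close>

lemma distr_block_law_restrict:
  assumes "\<And>i. X i \<in> borel_measurable M" "n \<le> k"
  shows "distr (block_law M X k) (Pi\<^sub>M {..<n} (\<lambda>_. borel)) (\<lambda>x. \<lambda>i\<in>{..<n}. x i) = block_law M X n"
  unfolding block_law_def using assms
  by (subst distr_distr[OF measurable_coordinates measurable_block])
    (auto intro!: distr_cong simp: comp_def restrict_def)

lemma distr_block_law_shift:
  assumes "\<And>i. X i \<in> borel_measurable M"
  shows "distr (block_law M X (n + m)) (Pi\<^sub>M {..<m} (\<lambda>_. borel)) (\<lambda>x. \<lambda>i\<in>{..<m}. x (n + i))
    = block_law M (\<lambda>i. X (n + i)) m"
  unfolding block_law_def using assms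
  by (subst distr_distr[OF measurable_coordinates measurable_block])
    (auto intro!: distr_cong simp: comp_def restrict_def)

lemma block_law_gaussian_shift:
  assumes "independent_gaussian_process N \<eta>"
  shows "block_law N (\<lambda>i. \<eta> (n + i)) m = block_law N \<eta> m"
proof -
  let ?D = "density lborel (\<lambda>x. ennreal (std_normal_density x))"
  have "block_law N (\<lambda>i. \<eta> (n + i)) m
    = distr (Pi\<^sub>M {..<n + m} (\<lambda>_. ?D)) (Pi\<^sub>M {..<m} (\<lambda>_. borel)) (\<lambda>x. \<lambda>i\<in>{..<m}. x (n + i))"
    using distr_block_law_shift[of \<eta> N n m] independent_gaussian_processD(3)[OF assms]
    by (simp add: block_law_gaussian[OF assms] gauss_measure_eq_PiM)
  also have "\<dots> = distr (Pi\<^sub>M {..<n + m} (\<lambda>_. ?D)) (Pi\<^sub>M {..<m} (\<lambda>_. ?D)) (\<lambda>x. \<lambda>i\<in>{..<m}. x (n + i))"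
    by (intro distr_cong sets_PiM_cong) auto
  also have "\<dots> = Pi\<^sub>M {..<m} (\<lambda>_. ?D)"
    by (rule distr_PiM_reindex[of _ "\<lambda>_. ?D"]) (auto intro: prob_space_normal_density simp: inj_on_def)
  finally show ?thesis by (simp add: block_law_gaussian[OF assms] gauss_measure_eq_PiM)
qed

text \<open>This supplies the hypothesis \<open>indep\<close> of
  \<open>rel_entropy_superadditive\<close>. Vectors built from disjoint sets of indices of an
  independent family are independent.\<close>

lemma gaussian_blocks_independent:
  assumes "independent_gaussian_process N \<eta>"
    and E: "E \<in> sets (Pi\<^sub>M {..<n} (\<lambda>_. borel))" and E': "E' \<in> sets (Pi\<^sub>M {..<m} (\<lambda>_. borel))"
  shows "measure (block_law N \<eta> (n + m)) ((\<lambda>x. \<lambda>i\<in>{..<n}. x i) -` E \<inter> (\<lambda>x. \<lambda>i\<in>{..<m}. x (n + i)) -` E'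
      \<inter> space (block_law N \<eta> (n + m)))
    = measure (block_law N \<eta> n) E * measure (block_law N (\<lambda>i. \<eta> (n + i)) m) E'"
proof -
  note g = independent_gaussian_processD[OF assms(1)]
  note [measurable] = g(3) E E'
  interpret N: prob_space N by (rule g(1))
  let ?B = "\<lambda>I. Pi\<^sub>M I (\<lambda>_. borel :: real measure)"
  let ?U = "\<lambda>\<omega>. \<lambda>i\<in>{..<n}. \<eta> i \<omega>" and ?V = "\<lambda>\<omega>. \<lambda>i\<in>{..<m}. \<eta> (n + i) \<omega>"
  have [measurable]: "(\<lambda>x. \<lambda>i\<in>{..<n}. x i) \<in> ?B {..<n + m} \<rightarrow>\<^sub>M ?B {..<n}"
    "(\<lambda>x. \<lambda>i\<in>{..<m}. x (n + i)) \<in> ?B {..<n + m} \<rightarrow>\<^sub>M ?B {..<m}"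
    "(\<lambda>x. \<lambda>i\<in>{..<m}. x (n + i)) \<in> ?B {n..<n + m} \<rightarrow>\<^sub>M ?B {..<m}"
    by (auto intro!: measurable_coordinates)
  have "N.indep_var (?B {..<n}) ?U (?B {n..<n + m}) (\<lambda>\<omega>. \<lambda>i\<in>{n..<n + m}. \<eta> i \<omega>)"
    using g(2) by (rule N.indep_var_restrict) auto
  \<comment> \<open>Composition translates the second index set from \<open>{n..<n + m}\<close> to
    \<open>{..<m}\<close>.\<close>
  then have "N.indep_var (?B {..<n}) ((\<lambda>x. x) \<circ> ?U) (?B {..<m})
    ((\<lambda>x. \<lambda>i\<in>{..<m}. x (n + i)) \<circ> (\<lambda>\<omega>. \<lambda>i\<in>{n..<n + m}. \<eta> i \<omega>))"
    by (rule N.indep_var_compose) measurable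
  also have "(\<lambda>x. x) \<circ> ?U = ?U" by auto
  also have "(\<lambda>x. \<lambda>i\<in>{..<m}. x (n + i)) \<circ> (\<lambda>\<omega>. \<lambda>i\<in>{n..<n + m}. \<eta> i \<omega>) = ?V"
    by (auto simp: fun_eq_iff restrict_def)
  finally have indep: "N.prob ((\<lambda>\<omega>. (?U \<omega>, ?V \<omega>)) -` (E \<times> E') \<inter> space N)
    = N.prob (?U -` E \<inter> space N) * N.prob (?V -` E' \<inter> space N)"
    using E E' by (rule N.indep_varD)
  let ?S = "(\<lambda>x. \<lambda>i\<in>{..<n}. x i) -` E \<inter> (\<lambda>x. \<lambda>i\<in>{..<m}. x (n + i)) -` E' \<inter> space (?B {..<n + m})"
  have S: "?S \<in> sets (?B {..<n + m})"
  proof -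
    have "?S = ((\<lambda>x. \<lambda>i\<in>{..<n}. x i) -` E \<inter> space (?B {..<n + m}))
        \<inter> ((\<lambda>x. \<lambda>i\<in>{..<m}. x (n + i)) -` E' \<inter> space (?B {..<n + m}))" by auto
    then show ?thesis by (simp add: measurable_sets)
  qed
  have "measure (block_law N \<eta> (n + m)) ?S = N.prob ((\<lambda>\<omega>. \<lambda>i\<in>{..<n + m}. \<eta> i \<omega>) -` ?S \<inter> space N)"
    unfolding block_law_def using S by (intro measure_distr) measurable
  also have "(\<lambda>\<omega>. \<lambda>i\<in>{..<n + m}. \<eta> i \<omega>) -` ?S \<inter> space N
    = (\<lambda>\<omega>. (?U \<omega>, ?V \<omega>)) -` (E \<times> E') \<inter> space N"
    by (auto simp: space_PiM restrict_def PiE_def extensional_def cong: if_cong split: if_splits)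
  also note indep
  also have "N.prob (?U -` E \<inter> space N) = measure (block_law N \<eta> n) E"
    unfolding block_law_def by (subst measure_distr) auto
  also have "N.prob (?V -` E' \<inter> space N) = measure (block_law N (\<lambda>i. \<eta> (n + i)) m) E'"
    unfolding block_law_def by (subst measure_distr) auto
  finally show ?thesis unfolding space_block_law .
qed

subsection \<open>Entropy of a block\<close>

text \<open>If \<open>b\<close> is integrable, this is linearity. Otherwise the positive part of
  \<open>a - b\<close> is dominated by the integrable function \<open>norm (a x)\<close>, while
  \<open>b\<close> is at most \<open>norm (a x)\<close> plus the negative part of
  \<open>a - b\<close>, whose integral is then infinite; both sides are
  \<open>- \<infinity>\<close>.\<close>

lemma ext_integral_diff:
  fixes a b :: "'a \<Rightarrow> real"
  assumes a: "integrable M a" and [measurable]: "b \<in> borel_measurable M" and b: "\<And>x. 0 \<le> b x"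
  shows "ext_integral M (\<lambda>x. a x - b x)
    = ereal (\<integral>x. a x \<partial>M) - enn2ereal (\<integral>\<^sup>+x. ennreal (b x) \<partial>M)"
proof -
  have [measurable]: "a \<in> borel_measurable M" using a by auto
  have fin: "(\<integral>\<^sup>+x. ennreal (norm (a x)) \<partial>M) < \<infinity>"
    using a by (simp add: integrable_iff_bounded)
  show ?thesis
  proof (cases "(\<integral>\<^sup>+x. ennreal (b x) \<partial>M) = \<infinity>")
    case False
    then have ib: "integrable M b"
      using b by (intro integrableI_nonneg) (auto simp: less_top)
    then have iab: "integrable M (\<lambda>x. a x - b x)" using a by simp
    have i: "(\<integral>\<^sup>+x. ennreal (a x - b x) \<partial>M) \<noteq> \<infinity>" "(\<integral>\<^sup>+x. ennreal (- (a x - b x)) \<partial>M) \<noteq> \<infinity>"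
      using iab unfolding real_integrable_def by auto
    have "(\<integral>x. a x \<partial>M) - (\<integral>x. b x \<partial>M)
      = enn2real (\<integral>\<^sup>+x. ennreal (a x - b x) \<partial>M) - enn2real (\<integral>\<^sup>+x. ennreal (- (a x - b x)) \<partial>M)"
      using real_lebesgue_integral_def[OF iab] a ib by simp
    moreover have "enn2ereal (\<integral>\<^sup>+x. ennreal (b x) \<partial>M) = ereal (\<integral>x. b x \<partial>M)"
      using nn_integral_eq_integral[OF ib] b by (simp add: enn2ereal_ennreal integral_nonneg_AE)
    moreover have "enn2ereal z = ereal (enn2real z)" if "z \<noteq> \<infinity>" for z
      using that by (cases z) (auto simp: enn2ereal_ennreal)
    ultimately show ?thesis
      using i by (simp add: ext_integral_def)
  next
    case True
    have "(\<integral>\<^sup>+x. ennreal (a x - b x) \<partial>M) \<le> (\<integral>\<^sup>+x. ennreal (norm (a x)) \<partial>M)"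
      using b by (intro nn_integral_mono ennreal_leI) (simp add: diff_le_eq abs_le_iff add_increasing2)
    then have pos: "(\<integral>\<^sup>+x. ennreal (a x - b x) \<partial>M) < \<infinity>" using fin by (rule le_less_trans)
    have "(\<integral>\<^sup>+x. ennreal (b x) \<partial>M)
      \<le> (\<integral>\<^sup>+x. ennreal (norm (a x)) + ennreal (- (a x - b x)) \<partial>M)"
    proof (rule nn_integral_mono)
      fix x
      have "ennreal (b x) \<le> ennreal (norm (a x) + max 0 (- (a x - b x)))"
        by (intro ennreal_leI) auto
      also have "\<dots> = ennreal (norm (a x)) + ennreal (- (a x - b x))"
        by (subst ennreal_plus) (auto simp: max_def ennreal_neg)
      finally show "ennreal (b x) \<le> ennreal (norm (a x)) + ennreal (- (a x - b x))" .
    qed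
    also have "\<dots> = (\<integral>\<^sup>+x. ennreal (norm (a x)) \<partial>M) + (\<integral>\<^sup>+x. ennreal (- (a x - b x)) \<partial>M)"
      by (intro nn_integral_add) auto
    finally have "(\<integral>\<^sup>+x. ennreal (- (a x - b x)) \<partial>M) = \<infinity>"
      using True fin by (auto simp: top_unique)
    moreover obtain r where "(\<integral>\<^sup>+x. ennreal (a x - b x) \<partial>M) = ennreal r" "0 \<le> r"
      using pos by (cases "\<integral>\<^sup>+x. ennreal (a x - b x) \<partial>M") auto
    ultimately show ?thesis
      using True by (simp add: ext_integral_def enn2ereal_ennreal)
  qed
qed

lemma gauss_density_pos: "0 < gauss_density n x"
  unfolding gauss_density_def by (intro prod_pos) (simp add: normal_density_pos)

lemma ln_gauss_density: "ln (gauss_density n x) = - (\<Sum>i<n. (ln (2 * pi) + (x i)\<^sup>2) / 2)"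
proof -
  have "ln (std_normal_density y) = - ((ln (2 * pi) + y\<^sup>2) / 2)" for y
    by (simp add: std_normal_density_def ln_mult ln_div ln_sqrt field_simps)
  moreover have "ln (gauss_density n x) = (\<Sum>i<n. ln (std_normal_density (x i)))"
    unfolding gauss_density_def
    by (rule ln_prod) (simp_all add: normal_density_pos less_imp_neq[symmetric])
  ultimately show ?thesis by (simp add: sum_negf)
qed

text \<open>\<open>AC\<close> speaks of \<open>n \<ge> 1\<close>, while superadditivity is stated
  for all lengths. \<open>leb 0\<close> is the counting measure on one point, so its only null set
  is empty.\<close>

lemma absolutely_continuous_leb_0:
  "absolutely_continuous (leb 0) (block_law M X 0)"
  by (simp add: absolutely_continuous_def leb_def PiM_empty null_sets_count_space)

text \<open>The Radon-Nikodym derivative is finite almost everywhere because the block law is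
  sigma-finite, so passing through \<open>enn2real\<close> changes it on a null set only.\<close>

lemma block_law_eq_density:
  assumes "absolutely_continuous (leb n) (block_law M X n)"
    and "prob_space M" "\<And>i. X i \<in> borel_measurable M"
  shows "block_law M X n
    = density (leb n) (\<lambda>x. ennreal (enn2real (RN_deriv (leb n) (block_law M X n) x)))"
proof -
  interpret sigma_finite_measure "leb n" by (rule sigma_finite_leb)
  interpret P: prob_space "block_law M X n"
    using assms(2,3) by (rule prob_space_block_law)
  have sets: "sets (block_law M X n) = sets (leb n)" by (simp add: sets_leb)
  have "AE x in leb n. RN_deriv (leb n) (block_law M X n) x \<noteq> \<infinity>"
    using assms(1) sets by (intro RN_deriv_finite P.sigma_finite_measure_axioms)
  then have "density (leb n) (RN_deriv (leb n) (block_law M X n))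
    = density (leb n) (\<lambda>x. ennreal (enn2real (RN_deriv (leb n) (block_law M X n) x)))"
    by (intro density_cong) (auto elim!: eventually_mono simp: less_top)
  then show ?thesis using density_RN_deriv[OF assms(1) sets] by simp
qed

text \<open>The Gaussian density vanishes nowhere, so dividing by it turns a Lebesgue density into a
  density with respect to \<open>gauss_measure n\<close>.\<close>

lemma density_eq_density_gauss_measure:
  fixes f :: "(nat \<Rightarrow> real) \<Rightarrow> real"
  assumes [measurable]: "f \<in> borel_measurable (leb n)"
  shows "density (gauss_measure n) (\<lambda>x. ennreal (f x / gauss_density n x))
    = density (leb n) (\<lambda>x. ennreal (f x))"
proof -
  have "density (gauss_measure n) (\<lambda>x. ennreal (f x / gauss_density n x))
    = density (leb n) (\<lambda>x. ennreal (gauss_density n x) * ennreal (f x / gauss_density n x))"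
    by (intro density_density_eq) measurable
  also have "(\<lambda>x. ennreal (gauss_density n x) * ennreal (f x / gauss_density n x)) = (\<lambda>x. ennreal (f x))"
  proof
    show "ennreal (gauss_density n x) * ennreal (f x / gauss_density n x) = ennreal (f x)" for x
      using gauss_density_pos[of n x] by (subst ennreal_mult'[symmetric]) (simp_all add: less_imp_le)
  qed
  finally show ?thesis .
qed

lemma absolutely_continuous_gauss_measure:
  assumes "absolutely_continuous (leb n) (block_law M X n)"
    and "prob_space M" "\<And>i. X i \<in> borel_measurable M"
  shows "absolutely_continuous (gauss_measure n) (block_law M X n)"
proof -
  define f where "f x = enn2real (RN_deriv (leb n) (block_law M X n) x)" for x
  have [measurable]: "f \<in> borel_measurable (leb n)" unfolding f_def by measurable
  have "block_law M X n = density (leb n) (\<lambda>x. ennreal (f x))"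
    using block_law_eq_density[OF assms] by (simp add: f_def)
  then have "block_law M X n = density (gauss_measure n) (\<lambda>x. ennreal (f x / gauss_density n x))"
    using density_eq_density_gauss_measure[of f n] by simp
  then show ?thesis by (simp add: absolutely_continuousI_density)
qed

text \<open>By \<open>ln_gauss_density\<close> the function is a sum of \<open>n\<close> quadratic
  terms, one per coordinate, so only the common second moment \<open>s\<close> enters. This produces
  the constant in the entropy formula.\<close>

lemma block_law_second_moment:
  assumes "prob_space M" "\<And>i. X i \<in> borel_measurable M"
    and "\<And>i. integrable M (\<lambda>\<omega>. (X i \<omega>)\<^sup>2)" "\<And>i. (\<integral>\<omega>. (X i \<omega>)\<^sup>2 \<partial>M) = s"
  shows "integrable (block_law M X n) (\<lambda>x. - ln (gauss_density n x))"
    and "(\<integral>x. - ln (gauss_density n x) \<partial>block_law M X n) = real n * (1 / 2 * (ln (2 * pi) + s))"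
proof -
  interpret prob_space M by fact
  note [measurable] = assms(2)
  let ?w = "\<lambda>x :: nat \<Rightarrow> real. \<Sum>i<n. (ln (2 * pi) + (x i)\<^sup>2) / 2"
  have w: "(\<lambda>x. - ln (gauss_density n x)) = ?w" by (simp add: ln_gauss_density)
  have m: "?w \<in> borel_measurable (Pi\<^sub>M {..<n} (\<lambda>_. borel))"
  proof (rule borel_measurable_sum)
    fix i assume "i \<in> {..<n}"
    then have [measurable]: "(\<lambda>x. x i) \<in> borel_measurable (Pi\<^sub>M {..<n} (\<lambda>_. borel :: real measure))"
      by (rule measurable_component_singleton)
    show "(\<lambda>x. (ln (2 * pi) + (x i)\<^sup>2) / 2) \<in> borel_measurable (Pi\<^sub>M {..<n} (\<lambda>_. borel))"
      by measurable
  qed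
  have eq: "?w (\<lambda>i\<in>{..<n}. X i \<omega>) = (\<Sum>i<n. (ln (2 * pi) + (X i \<omega>)\<^sup>2) / 2)" for \<omega>
    by (intro sum.cong) auto
  have int: "integrable M (\<lambda>\<omega>. (ln (2 * pi) + (X i \<omega>)\<^sup>2) / 2)" for i
    using assms(3)[of i] by simp
  show "integrable (block_law M X n) (\<lambda>x. - ln (gauss_density n x))"
    unfolding w block_law_def
    unfolding integrable_distr_eq[OF measurable_block[OF assms(2)] m] eq
    by (intro Bochner_Integration.integrable_sum int)
  have "(\<integral>x. ?w x \<partial>block_law M X n) = (\<integral>\<omega>. (\<Sum>i<n. (ln (2 * pi) + (X i \<omega>)\<^sup>2) / 2) \<partial>M)"
    unfolding block_law_def integral_distr[OF measurable_block[OF assms(2)] m] eq ..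
  also have "\<dots> = (\<Sum>i<n. \<integral>\<omega>. (ln (2 * pi) + (X i \<omega>)\<^sup>2) / 2 \<partial>M)"
    by (intro Bochner_Integration.integral_sum int)
  also have "\<dots> = real n * (1 / 2 * (ln (2 * pi) + s))"
    using assms(3,4) by (simp add: prob_space)
  finally show "(\<integral>x. - ln (gauss_density n x) \<partial>block_law M X n) = real n * (1 / 2 * (ln (2 * pi) + s))"
    unfolding w .
qed

text \<open>
  With \<open>f\<close> the Lebesgue density of the block, \<open>\<phi>\<close> the Gaussian density, \<open>g = f / \<phi>\<close> and
  \<open>h x = x ln x - x + 1\<close>, the integrand \<open>- f ln f\<close> is the integrable function
  \<open>- f ln \<phi> - f + \<phi>\<close> minus the nonnegative function \<open>\<phi> * h g\<close>, whose integral is the relative entropy.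
\<close>

lemma ext_integral_psi_density:
  assumes ac: "absolutely_continuous (leb n) (block_law M X n)"
    and M: "prob_space M" and X: "\<And>i. X i \<in> borel_measurable M"
    and sq: "\<And>i. integrable M (\<lambda>\<omega>. (X i \<omega>)\<^sup>2)" "\<And>i. (\<integral>\<omega>. (X i \<omega>)\<^sup>2 \<partial>M) = s"
  shows "ext_integral (leb n) (\<lambda>x. psi (enn2real (RN_deriv (leb n) (block_law M X n) x)))
    = ereal (real n * (1 / 2 * (ln (2 * pi) + s))) - rel_entropy (gauss_measure n) (block_law M X n)"
proof -
  define f where "f x = enn2real (RN_deriv (leb n) (block_law M X n) x)" for x
  define g where "g x = f x / gauss_density n x" for x
  define A where "A x = f x * - ln (gauss_density n x) - f x + gauss_density n x" for x
  define B where "B x = gauss_density n x * (g x * ln (g x) - g x + 1)" for x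
  have f_nonneg: "0 \<le> f x" for x by (simp add: f_def)
  have [measurable]: "f \<in> borel_measurable (leb n)" unfolding f_def by measurable
  have [measurable]: "g \<in> borel_measurable (leb n)" unfolding g_def by measurable
  have [measurable]: "B \<in> borel_measurable (leb n)" unfolding B_def by measurable
  have pos: "0 < gauss_density n x" for x by (rule gauss_density_pos)
  have g_nonneg: "0 \<le> g x" for x using f_nonneg pos[of x] by (simp add: g_def)
  have P: "block_law M X n = density (leb n) (\<lambda>x. ennreal (f x))"
    using block_law_eq_density[OF ac M X] by (simp add: f_def)
  also have "\<dots> = density (gauss_measure n) (\<lambda>x. ennreal (g x))"
    unfolding g_def by (rule density_eq_density_gauss_measure[symmetric]) simp
  finally have PQ: "block_law M X n = density (gauss_measure n) (\<lambda>x. ennreal (g x))" .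
  have prob: "prob_space (block_law M X n)" by (rule prob_space_block_law[OF M X])
  have h: "0 \<le> g x * ln (g x) - g x + 1" for x
    using ln_mult_le[OF g_nonneg[of x], of 1] by simp
  then have B: "0 \<le> B x" for x using pos[of x] by (simp add: B_def)
  \<comment> \<open>Where \<open>f\<close> vanishes, so does \<open>g\<close>, and both
    \<open>A\<close> and \<open>B\<close> equal the Gaussian density.\<close>
  have psi: "psi (f x) = A x - B x" for x
  proof (cases "f x = 0")
    case False
    then have "0 < f x" using f_nonneg[of x] by (simp add: less_le)
    then show ?thesis
      using pos[of x] by (simp add: psi_def A_def B_def g_def ln_div field_simps)
  qed (simp add: psi_def A_def B_def g_def)
  have moment: "integrable (leb n) (\<lambda>x. f x * - ln (gauss_density n x))"
    "(\<integral>x. f x * - ln (gauss_density n x) \<partial>leb n) = real n * (1 / 2 * (ln (2 * pi) + s))"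
    using block_law_second_moment[where n = n and X = X, OF M X sq] f_nonneg
    unfolding P by (simp_all add: integrable_density integral_density)
  have f1: "integrable (leb n) f" "(\<integral>x. f x \<partial>leb n) = 1"
    using prob_density_integral[of f "leb n"] f_nonneg prob unfolding P by auto
  have G1: "integrable (leb n) (gauss_density n)" "(\<integral>x. gauss_density n x \<partial>leb n) = 1"
    using prob_density_integral[of "gauss_density n" "leb n"] prob_space_gauss_measure[of n] pos
    by (auto simp: less_imp_le)
  \<comment> \<open>The total masses of \<open>f\<close> and of the Gaussian density are both
    \<open>1\<close> and cancel, leaving the moment term.\<close>
  have A: "integrable (leb n) A" "(\<integral>x. A x \<partial>leb n) = real n * (1 / 2 * (ln (2 * pi) + s))"
    unfolding A_def using moment f1 G1 by auto
  have "rel_entropy (gauss_measure n) (block_law M X n)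
    = enn2ereal (\<integral>\<^sup>+x. ennreal (g x * ln (g x) - g x + 1) \<partial>gauss_measure n)"
    using prob unfolding PQ
    by (intro rel_entropy_density prob_space_gauss_measure g_nonneg) simp_all
  also have "(\<integral>\<^sup>+x. ennreal (g x * ln (g x) - g x + 1) \<partial>gauss_measure n) = (\<integral>\<^sup>+x. ennreal (B x) \<partial>leb n)"
    unfolding B_def using pos h
    by (subst nn_integral_density) (auto simp: ennreal_mult less_imp_le)
  finally show ?thesis
    using ext_integral_diff[OF A(1) \<open>B \<in> borel_measurable (leb n)\<close> B]
    by (simp add: A(2) psi flip: f_def)
qed

subsection \<open>Entropy rate\<close>

text \<open>Cylinders over finite index sets determine a law on sequences, and every such cylinder
  is the preimage of a set in a sufficiently long block.\<close>

lemma process_law_eqI: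
  assumes N: "prob_space N" "\<And>i. Y i \<in> borel_measurable N"
    and M: "prob_space M" "\<And>i. X i \<in> borel_measurable M"
    and eq: "\<And>n. 1 \<le> n \<Longrightarrow> block_law M X n = block_law N Y n"
  shows "process_law M X = process_law N Y"
proof (rule measure_eqI_PiM_infinite)
  have X: "(\<lambda>\<omega> i. X i \<omega>) \<in> M \<rightarrow>\<^sub>M Pi\<^sub>M UNIV (\<lambda>_. borel)"
    and Y: "(\<lambda>\<omega> i. Y i \<omega>) \<in> N \<rightarrow>\<^sub>M Pi\<^sub>M UNIV (\<lambda>_. borel)"
    using M(2) N(2) by (auto intro!: measurable_PiM_single')
  show "finite_measure (process_law M X)"
    unfolding process_law_def
    using prob_space.prob_space_distr[OF M(1) X] by (rule prob_space.finite_measure)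
  fix A :: "nat \<Rightarrow> real set" and J :: "nat set"
  assume J: "finite J" and "\<And>i. i \<in> J \<Longrightarrow> A i \<in> sets borel"
  note A = this(2)
  \<comment> \<open>Inserting \<open>0\<close> keeps the maximum meaningful for empty
    \<open>J\<close>; the successor gives \<open>J \<subseteq> {..<n}\<close> and
    \<open>1 \<le> n\<close>.\<close>
  define n where "n = Suc (Max (insert 0 J))"
  have Jn: "i < n" if "i \<in> J" for i
    using Max_ge[of "insert 0 J" i] that J by (simp add: n_def less_Suc_eq_le)
  define S where "S = prod_emb {..<n} (\<lambda>_. borel :: real measure) J (Pi\<^sub>E J A)"
  have S: "S \<in> sets (Pi\<^sub>M {..<n} (\<lambda>_. borel))"
    unfolding S_def using J A Jn by (intro sets_PiM_I) auto
  have emb: "prod_emb UNIV (\<lambda>_. borel :: real measure) J (Pi\<^sub>E J A) \<in> sets (Pi\<^sub>M UNIV (\<lambda>_. borel))"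
    using J A by (intro sets_PiM_I) auto
  have pre: "emeasure (process_law L Z) (prod_emb UNIV (\<lambda>_. borel) J (Pi\<^sub>E J A)) = emeasure (block_law L Z n) S"
    if Z: "(\<lambda>\<omega> i. Z i \<omega>) \<in> L \<rightarrow>\<^sub>M Pi\<^sub>M UNIV (\<lambda>_. borel)" "\<And>i. Z i \<in> borel_measurable L"
    for L :: "'z measure" and Z
  proof -
    have "(\<lambda>\<omega> i. Z i \<omega>) -` prod_emb UNIV (\<lambda>_. borel) J (Pi\<^sub>E J A) \<inter> space L
      = (\<lambda>\<omega>. \<lambda>i\<in>{..<n}. Z i \<omega>) -` S \<inter> space L"
      using Jn by (auto simp: S_def prod_emb_def PiE_iff restrict_def extensional_def)
    then show ?thesis
      unfolding process_law_def block_law_def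
      using emeasure_distr[OF Z(1) emb] emeasure_distr[OF measurable_block[OF Z(2)] S] by simp
  qed
  show "emeasure (process_law M X) (prod_emb UNIV (\<lambda>_. borel) J (Pi\<^sub>E J A))
      = emeasure (process_law N Y) (prod_emb UNIV (\<lambda>_. borel) J (Pi\<^sub>E J A))"
    using pre[OF X M(2)] pre[OF Y N(2)] eq[of n] by (simp add: n_def)
qed simp_all

lemma block_law_eq_distr_process_law:
  assumes "\<And>i. X i \<in> borel_measurable M"
  shows "block_law M X n = distr (process_law M X) (Pi\<^sub>M {..<n} (\<lambda>_. borel)) (\<lambda>x. \<lambda>i\<in>{..<n}. x i)"
proof -
  have "(\<lambda>\<omega> i. X i \<omega>) \<in> M \<rightarrow>\<^sub>M Pi\<^sub>M UNIV (\<lambda>_. borel)"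
    using assms by (auto intro!: measurable_PiM_single')
  then show ?thesis
    unfolding block_law_def process_law_def
    by (subst distr_distr[OF measurable_coordinates]) (auto simp: comp_def)
qed

theorem corollary5p4:
  fixes N :: "'b measure" and \<eta> :: "nat \<Rightarrow> 'b \<Rightarrow> real"
    and M :: "'a measure" and T :: "'a \<Rightarrow> 'a" and F :: "'a \<Rightarrow> real"
  assumes "independent_gaussian_process N \<eta>"
    and "dynamical_system M T"
    and "F \<in> AC M T"
  shows "(\<bar>Se M T F\<bar> \<noteq> \<infinity> \<longleftrightarrow> \<bar>entropy_rate N \<eta> M (orbit_process F T)\<bar> \<noteq> \<infinity>) \<and>
    (process_law M (orbit_process F T) = process_law N \<eta> \<longleftrightarrow>
       entropy_rate N \<eta> M (orbit_process F T) = 0) \<and>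
    Se M T F = ereal (1 / 2 * (ln (2 * pi) + (L2_norm M F)\<^sup>2))
       - entropy_rate N \<eta> M (orbit_process F T)"
proof -
  let ?X = "orbit_process F T"
  note g = independent_gaussian_processD[OF assms(1)]
  interpret M: dynamical_system M T by fact
  have F[measurable]: "F \<in> borel_measurable M" and F2: "integrable M (\<lambda>\<omega>. (F \<omega>)\<^sup>2)"
    using assms(3) by (auto simp: AC_def)
  note X = orbit_process_measurable[OF assms(2) F]
  have M: "prob_space M" by (rule M.prob_space_axioms)
  have ac_leb: "absolutely_continuous (leb n) (block_law M ?X n)" for n
    using assms(3) absolutely_continuous_leb_0[of M ?X] by (cases "n = 0") (auto simp: AC_def)
  have ac: "absolutely_continuous (block_law N \<eta> n) (block_law M ?X n)" for n
    unfolding block_law_gaussian[OF assms(1)]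
    by (rule absolutely_continuous_gauss_measure[OF ac_leb M X])
  have PM: "prob_space (block_law M ?X n)" and PN: "prob_space (block_law N \<eta> n)" for n
    using X g(1,3) M by (auto intro: prob_space_block_law)
  define r where "r n = rel_entropy (block_law N \<eta> n) (block_law M ?X n)" for n
  define c where "c = 1 / 2 * (ln (2 * pi) + (L2_norm M F)\<^sup>2)"
  have norm: "(L2_norm M F)\<^sup>2 = (\<integral>\<omega>. (F \<omega>)\<^sup>2 \<partial>M)"
    by (simp add: L2_norm_def)
  have X2: "integrable M (\<lambda>\<omega>. (?X i \<omega>)\<^sup>2)" "(\<integral>\<omega>. (?X i \<omega>)\<^sup>2 \<partial>M) = (L2_norm M F)\<^sup>2" for i
  proof -
    have [measurable]: "T \<in> M \<rightarrow>\<^sub>M M" by (rule M.measurable_T)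
    have "integrable (distr M M (T ^^ i)) (\<lambda>\<omega>. (F \<omega>)\<^sup>2)"
      "(\<integral>\<omega>. (F \<omega>)\<^sup>2 \<partial>distr M M (T ^^ i)) = (L2_norm M F)\<^sup>2"
      unfolding distr_funpow_preserving[OF assms(2)] by (simp_all add: F2 norm)
    then show "integrable M (\<lambda>\<omega>. (?X i \<omega>)\<^sup>2)" "(\<integral>\<omega>. (?X i \<omega>)\<^sup>2 \<partial>M) = (L2_norm M F)\<^sup>2"
      unfolding orbit_process_def by (simp_all add: integrable_distr_eq integral_distr)
  qed
  have entropy: "block_entropy M T F n = ereal (real n * c) - r n" for n
    unfolding block_entropy_def r_def c_def block_law_gaussian[OF assms(1)]
    by (rule ext_integral_psi_density[OF ac_leb M X X2])
  have r_nonneg: "0 \<le> r n" for n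
    unfolding r_def using PM PN by (intro rel_entropy_nonneg) auto
  have super: "r n + r m \<le> r (n + m)" for n m
  proof -
    let ?a = "\<lambda>x :: nat \<Rightarrow> real. \<lambda>i\<in>{..<n}. x i" and ?b = "\<lambda>x :: nat \<Rightarrow> real. \<lambda>i\<in>{..<m}. x (n + i)"
    have a: "?a \<in> block_law N \<eta> (n + m) \<rightarrow>\<^sub>M Pi\<^sub>M {..<n} (\<lambda>_. borel)"
      and b: "?b \<in> block_law N \<eta> (n + m) \<rightarrow>\<^sub>M Pi\<^sub>M {..<m} (\<lambda>_. borel)"
      unfolding measurable_cong_sets[OF sets_block_law refl]
      by (auto intro!: measurable_coordinates)
    \<comment> \<open>The first marginal is an \<open>n\<close>-block as it stands; the second is a
      shifted \<open>m\<close>-block, which stationarity of both processes brings back to the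
      start.\<close>
    show ?thesis
      using rel_entropy_superadditive[OF PM PN _ ac a b] gaussian_blocks_independent[OF assms(1)]
        block_law_gaussian_shift[OF assms(1)] block_law_shift[OF assms(2) F]
      by (simp add: r_def distr_block_law_restrict[OF X] distr_block_law_restrict[OF g(3)]
          distr_block_law_shift[OF X] distr_block_law_shift[OF g(3)])
  qed
  define L where "L = (SUP k\<in>{1..}. ereal (1 / real k) * r k)"
  have lim: "(\<lambda>n. ereal (1 / real n) * r n) \<longlonglongrightarrow> L"
    unfolding L_def by (rule superadditive_tendsto_SUP[OF r_nonneg super])
  then have rate: "entropy_rate N \<eta> M ?X = L"
    unfolding entropy_rate_def r_def by (rule limI)
  have le_L: "ereal (1 / real n) * r n \<le> L" if "1 \<le> n" for n
    unfolding L_def using that by (intro SUP_upper) auto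
  have L_nonneg: "0 \<le> L" using le_L[of 1] r_nonneg[of 1] by (auto simp flip: one_ereal_def)
  \<comment> \<open>The constant \<open>c\<close> is finite, so the difference is continuous even at
    \<open>L = \<infinity>\<close>.\<close>
  have "(\<lambda>n. ereal c - ereal (1 / real n) * r n) \<longlonglongrightarrow> ereal c - L"
    using L_nonneg lim by (intro tendsto_diff_ereal_general tendsto_const) auto
  \<comment> \<open>The identity is taken for \<open>n > 0\<close>: at \<open>n = 0\<close>, where
    \<open>1 / real 0 = 0\<close>, the left side is \<open>c\<close> and the right side
    \<open>0\<close>.\<close>
  moreover have "eventually (\<lambda>n. ereal c - ereal (1 / real n) * r n
      = ereal (1 / real n) * block_entropy M T F n) sequentially"
    using eventually_gt_at_top[of 0]
  proof eventually_elim
    case (elim n)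
    then show ?case
      using r_nonneg[of n] by (cases "r n") (auto simp: entropy field_simps)
  qed
  ultimately have "(\<lambda>n. ereal (1 / real n) * block_entropy M T F n) \<longlonglongrightarrow> ereal c - L"
    by (rule Lim_transform_eventually)
  then have Se: "Se M T F = ereal c - L" unfolding Se_def by (rule limI)
  have "process_law M ?X = process_law N \<eta> \<longleftrightarrow> L = 0"
  proof
    assume eq: "process_law M ?X = process_law N \<eta>"
    have "r n = 0" for n
      unfolding r_def block_law_eq_distr_process_law[OF X] block_law_eq_distr_process_law[OF g(3)] eq
      unfolding block_law_eq_distr_process_law[OF g(3), symmetric] by (rule rel_entropy_self[OF PN])
    then show "L = 0" by (simp add: L_def)
  next
    assume "L = 0"
    \<comment> \<open>As \<open>L\<close> is the supremum of the normalised relative entropies,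
      \<open>L = 0\<close> annihilates each of them, not just their limit.\<close>
    have "block_law M ?X n = block_law N \<eta> n" if "1 \<le> n" for n
    proof (rule rel_entropy_eq_0_imp_eq[OF PM PN _ ac])
      have "ereal (1 / real n) * r n \<le> 0" using le_L[OF that] \<open>L = 0\<close> by simp
      then show "rel_entropy (block_law N \<eta> n) (block_law M ?X n) \<le> 0"
        using that r_nonneg[of n] unfolding r_def[symmetric]
        by (cases "r n") (auto simp: zero_ereal_def field_simps)
    qed simp
    then show "process_law M ?X = process_law N \<eta>"
      by (rule process_law_eqI[OF g(1,3) M X])
  qed
  moreover have "\<bar>ereal c - L\<bar> \<noteq> \<infinity> \<longleftrightarrow> \<bar>L\<bar> \<noteq> \<infinity>" by (cases L) auto
  ultimately show ?thesis
    unfolding rate Se c_def[symmetric] by blast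
qed

end
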